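(* Let $p$ be a fixed prime number. Suppose the $p$-adic Digit Conjecture holds for $p$, i.e., there is a constant $c_p>0$ such that for every $f\in\mathbb{Z}[x_1]\setminus\{0\}$ the number of distinct roots $x\in\mathbb{Z}$ of $f$ with $x\equiv 1 \pmod p$ is at most $(\tau(f)+1)^{c_p}$. Then $\mathbf{P}_{\mathbb{C}}\neq\mathbf{NP}_{\mathbb{C}}$. In particular, under the same supposition on $p$, the Shub-Smale $\tau$-Conjecture is true: there is an absolute constant $\kappa\geq 1$ such that for every $f\in\mathbb{Z}[x_1]\setminus\{0\}$ the number of distinct roots of $f$ in $\mathbb{Z}$ is at most $(\tau(f)+1)^{\kappa}$.
   Context: **Straight-line programs and $\tau$.** For $f\in\mathbb{Z}[x_1]$ (one variable), a straight-line program (SLP) for $f$ is a sequence $(1,x_1,f_2,\ldots,f_N)$ with $f_0:=1$, $f_1:=x_1$, $f_N=f(x_1)$, such that for every $i\geq 2$ the polynomial $f_i$ is a sum, difference, or product of some pair of elements $(f_j,f_k)$ with $j,k<i$. Then $\tau(f)$ denotes the smallest possible value of $N-1$ over all such sequences computing $f$. **The classes $\mathbf{P}_{\mathbb{C}}$ and $\mathbf{NP}_{\mathbb{C}}$.** These are the analogues of $\mathbf{P}$ and $\mathbf{NP}$ in the Blum-Shub-Smale (BSS) model over $\mathbb{C}$: machines which use finitely many complex constants, perform arithmetic operations on complex numbers at unit cost, and branch on tests of equality to zero. Inputs are elements of $\mathbb{C}^{\infty}=\bigsqcup_{n\geq 1}\mathbb{C}^n$, where an element of $\mathbb{C}^n$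 has size $n$. A set $S\subseteq\mathbb{C}^\infty$ is in $\mathbf{P}_{\mathbb{C}}$ iff some BSS machine over $\mathbb{C}$ decides membership in $S$ in time polynomial in the input size. A set $S$ is in $\mathbf{NP}_{\mathbb{C}}$ iff there are a polynomial $q$ and a set $S'\in\mathbf{P}_{\mathbb{C}}$ such that for all $n$ and $x\in\mathbb{C}^n$: $x\in S$ iff there is $y\in\mathbb{C}^{q(n)}$ with $(x,y)\in S'$. *)

theory Defs
  imports
    Complex_Main
    "HOL-Computational_Algebra.Computational_Algebra"
    "HOL-Number_Theory.Cong"
begin

section \<open>Straight-line programs\<close>

text \<open>
  The list entry \<open>fs ! i\<close> is the polynomial \<open>f\<^sub>i\<close>. The two initial entries 1 and \<open>x\<^sub>1\<close> are always
  present, so that \<open>N \<ge> 1\<close>; in particular \<open>\<tau>(x\<^sub>1) = 0\<close> and \<open>\<tau>(1) = 1\<close>.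
\<close>

definition is_slp :: "int poly list \<Rightarrow> bool" where
  "is_slp fs \<longleftrightarrow>
     length fs \<ge> 2 \<and> fs ! 0 = 1 \<and> fs ! 1 = [:0, 1:] \<and>
     (\<forall>i. 2 \<le> i \<and> i < length fs \<longrightarrow>
        (\<exists>j<i. \<exists>k<i. fs ! i \<in> {fs ! j + fs ! k, fs ! j - fs ! k, fs ! j * fs ! k}))"

text \<open>
  A sequence with last index \<open>N\<close> has length \<open>N + 1\<close>, so \<open>N - 1 = m\<close> means length \<open>m + 2\<close>. Every
  integer polynomial is computed by some straight-line program, so the minimum exists.
\<close>

definition tau :: "int poly \<Rightarrow> nat" where
  "tau f = (LEAST m. \<exists>fs. is_slp fs \<and> last fs = f \<and> length fs = m + 2)"

definition digit_conjecture :: "nat \<Rightarrow> bool" where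
  "digit_conjecture p \<longleftrightarrow>
     (\<exists>c::real. c > 0 \<and>
        (\<forall>f::int poly. f \<noteq> 0 \<longrightarrow>
           real (card {x::int. poly f x = 0 \<and> [x = 1] (mod int p)}) \<le> (real (tau f) + 1) powr c))"

definition tau_conjecture :: bool where
  "tau_conjecture \<longleftrightarrow>
     (\<exists>\<kappa>::real. \<kappa> \<ge> 1 \<and>
        (\<forall>f::int poly. f \<noteq> 0 \<longrightarrow>
           real (card {x::int. poly f x = 0}) \<le> (real (tau f) + 1) powr \<kappa>))"


section \<open>Blum--Shub--Smale machines with equality tests\<close>

text \<open>
  The memory is a two-way infinite sequence of field elements. Instructions address finitely many
  fixed cells; the remaining cells are reached by shifting the whole sequence by one place.
  In the arithmetic instructions the first argument is the target cell. A program is a finite list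
  of instructions, so it contains finitely many constants; jump targets are positions in that list,
  and the machine halts when it leaves the list.
\<close>

datatype 'a instr =
    Const int 'a
  | Add int int int
  | Sub int int int
  | Mul int int int
  | Div int int int
  | IfZero int nat nat
  | ShiftL
  | ShiftR

type_synonym 'a machine = "'a instr list"
type_synonym 'a config = "nat \<times> (int \<Rightarrow> 'a)"

text \<open>
  Division by zero is undefined for these machines: the configuration is left unchanged, so a
  computation that attempts it never halts.
\<close>

fun exec :: "'a::field instr \<Rightarrow> 'a config \<Rightarrow> 'a config" where
  "exec (Const i c) (pc, s) = (Suc pc, s(i := c))"
| "exec (Add i j k) (pc, s) = (Suc pc, s(i := s j + s k))"
| "exec (Sub i j k) (pc, s) = (Suc pc, s(i := s j - s k))"
| "exec (Mul i j k) (pc, s) = (Suc pc, s(i := s j * s k))"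
| "exec (Div i j k) (pc, s) = (if s k = 0 then (pc, s) else (Suc pc, s(i := s j / s k)))"
| "exec (IfZero i l l') (pc, s) = ((if s i = 0 then l else l'), s)"
| "exec ShiftL (pc, s) = (Suc pc, \<lambda>i. s (i + 1))"
| "exec ShiftR (pc, s) = (Suc pc, \<lambda>i. s (i - 1))"

definition halted :: "'a machine \<Rightarrow> 'a config \<Rightarrow> bool" where
  "halted M cfg \<longleftrightarrow> fst cfg \<ge> length M"

definition step :: "'a::field machine \<Rightarrow> 'a config \<Rightarrow> 'a config" where
  "step M cfg = (if halted M cfg then cfg else exec (M ! fst cfg) cfg)"

text \<open>
  The input \<open>(x\<^sub>1, \<dots>, x\<^sub>n)\<close> is written to the cells \<open>1, \<dots>, n\<close>, and its size \<open>n\<close> is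
  supplied in unary by ones in the cells \<open>0, -1, \<dots>, -(n - 1)\<close>. Without the latter a machine could
  not tell where an input with zero coordinates ends.
\<close>

definition input_tape :: "'a::field list \<Rightarrow> int \<Rightarrow> 'a" where
  "input_tape x i =
     (if 1 \<le> i \<and> i \<le> int (length x) then x ! nat (i - 1)
      else if - int (length x) < i \<and> i \<le> 0 then 1
      else 0)"

definition run :: "'a::field machine \<Rightarrow> 'a list \<Rightarrow> nat \<Rightarrow> 'a config" where
  "run M x t = (step M ^^ t) (0, input_tape x)"

text \<open>An element of the \<open>n\<close>-th power of the complex numbers is a list of length \<open>n\<close>.\<close>

definition C_inf :: "complex list set" where
  "C_inf = {x. length x \<ge> 1}"

text \<open>
  The machine computes the characteristic function of \<open>S\<close>, with the answer in cell 1, and on inputs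
  of size \<open>n\<close> it halts after at most \<open>T n\<close> steps.
\<close>

definition decides_in_time :: "complex machine \<Rightarrow> complex list set \<Rightarrow> (nat \<Rightarrow> nat) \<Rightarrow> bool" where
  "decides_in_time M S T \<longleftrightarrow>
     (\<forall>x\<in>C_inf. \<exists>t \<le> T (length x).
        halted M (run M x t) \<and> snd (run M x t) 1 = (if x \<in> S then 1 else 0))"

definition P_C :: "complex list set set" where
  "P_C = {S. S \<subseteq> C_inf \<and> (\<exists>M. \<exists>q::nat poly. decides_in_time M S (poly q))}"

definition NP_C :: "complex list set set" where
  "NP_C = {S. S \<subseteq> C_inf \<and>
     (\<exists>q::nat poly. \<exists>S'\<in>P_C. \<forall>x\<in>C_inf.
        x \<in> S \<longleftrightarrow> (\<exists>y::complex list. length y = poly q (length x) \<and> x @ y \<in> S'))}"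

end

theory Submission
  imports Defs
begin

text \<open>
  The \<open>\<tau>\<close>-conjecture follows from the digit conjecture by translating each residue class modulo \<open>p\<close>
  to the class of 1.

  For the separation, suppose that some machine decides in polynomial time a suitable problem in NP
  (a prefix of a binary digit chain is extended by a guess) whose restriction to the inputs
  \<open>(z, \<dots>, z)\<close> of size \<open>n\<close> consists of integers only and includes \<open>0, \<dots>, 2\<^sup>n - 1\<close>. Along the path of a
  generic \<open>z\<close> the machine computes polynomially many polynomials in \<open>z\<close>, and every accepted \<open>z\<close> is
  a zero of the product of the nonzero ones. The complex constants of this straight-line program
  are then eliminated one at a time: a transcendental constant is replaced by a small integer, and an
  algebraic one by computing with coordinates in a power basis, of which some coordinate is a
  nonzero polynomial with the same integer zeros. The result is a nonzero integer polynomial of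
  polynomially bounded \<open>\<tau>\<close> with \<open>2\<^sup>n\<close> integer zeros, contradicting the \<open>\<tau>\<close>-conjecture.
\<close>

section \<open>Straight-line programs over commutative rings\<close>

text \<open>\<open>slp X n Y\<close>: at most \<open>n\<close> ring operations starting from \<open>X\<close> produce the elements of \<open>Y\<close>. The
  base rule admits every \<open>n\<close>, so that step counts are upper bounds.\<close>

inductive slp :: "'a::comm_ring_1 set \<Rightarrow> nat \<Rightarrow> 'a set \<Rightarrow> bool" for X where
  refl: "slp X n X"
| op: "slp X n Y \<Longrightarrow> a \<in> Y \<Longrightarrow> b \<in> Y \<Longrightarrow> c \<in> {a + b, a - b, a * b} \<Longrightarrow> slp X (Suc n) (insert c Y)"

lemma slp_mono_steps: "slp X n Y \<Longrightarrow> n \<le> m \<Longrightarrow> slp X m Y"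
proof (induction arbitrary: m rule: slp.induct)
  case (op n Y a b c)
  then obtain m' where "m = Suc m'" "n \<le> m'" by (cases m) auto
  then show ?case using op slp.op by blast
qed (rule slp.refl)

lemma slp_trans: "slp Y m Z \<Longrightarrow> slp X n Y \<Longrightarrow> slp X (n + m) Z"
proof (induction rule: slp.induct)
  case (refl m)
  then show ?case by (rule slp_mono_steps) simp
next
  case (op m Z a b c)
  then show ?case using slp.op[of X "n + m" Z a b c] by simp
qed

lemma slp_Un: "slp X n Y \<Longrightarrow> slp (X \<union> Z) n (Y \<union> Z)"
proof (induction rule: slp.induct)
  case (op n Y a b c)
  then show ?case using slp.op[of "X \<union> Z" n "Y \<union> Z" a b c] by auto
qed (rule slp.refl)

lemma slp_subset: "slp X n Y \<Longrightarrow> X \<subseteq> Y"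
  by (induction rule: slp.induct) auto

lemma slp_finite: "slp X n Y \<Longrightarrow> finite X \<Longrightarrow> finite Y \<and> card Y \<le> card X + n"
proof (induction rule: slp.induct)
  case (op n Y a b c)
  then show ?case by (simp add: card_insert_if)
qed simp

section \<open>Subrings, homomorphisms and the transport of programs\<close>

definition is_subring :: "'a::comm_ring_1 set \<Rightarrow> bool" where
  "is_subring K \<longleftrightarrow> 1 \<in> K \<and> (\<forall>a\<in>K. \<forall>b\<in>K. a + b \<in> K \<and> a - b \<in> K \<and> a * b \<in> K)"

lemma slp_subring: "slp X n Y \<Longrightarrow> is_subring K \<Longrightarrow> X \<subseteq> K \<Longrightarrow> Y \<subseteq> K"
proof (induction rule: slp.induct)
  case (op n Y a b c)
  then have "a \<in> K" "b \<in> K" by auto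
  then have "{a + b, a - b, a * b} \<subseteq> K" using op.prems unfolding is_subring_def by blast
  then show ?case using op by blast
qed

text \<open>Only the three operations of a straight-line program are recorded; the image of 1 is
  carried along as part of the image of the input set.\<close>

definition is_hom :: "('a::comm_ring_1 \<Rightarrow> 'b::comm_ring_1) \<Rightarrow> bool" where
  "is_hom h \<longleftrightarrow> (\<forall>a b. h (a + b) = h a + h b \<and> h (a - b) = h a - h b \<and> h (a * b) = h a * h b)"

lemma slp_hom: "slp X n Y \<Longrightarrow> is_hom h \<Longrightarrow> slp (h ` X) n (h ` Y)"
proof (induction rule: slp.induct)
  case (op n Y a b c)
  then show ?case using slp.op[of "h ` X" n "h ` Y" "h a" "h b" "h c"] by (auto simp: is_hom_def)
qed (rule slp.refl)

text \<open>Each operation is replayed on chosen preimages of its arguments, so \<open>h\<close> may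
  be far from injective. This pulls programs with complex constants back to programs over the
  integers, or with an indeterminate in place of a constant.\<close>

lemma slp_lift: "slp (h ` X) n Y \<Longrightarrow> is_hom h \<Longrightarrow> \<exists>Y'. slp X n Y' \<and> Y = h ` Y'"
proof (induction rule: slp.induct)
  case (refl n)
  then show ?case using slp.refl by blast
next
  case (op n Y a b c)
  then obtain Y' where Y': "slp X n Y'" "Y = h ` Y'" by blast
  then obtain a' b' where ab: "a' \<in> Y'" "b' \<in> Y'" "a = h a'" "b = h b'" using op by auto
  then have "\<exists>c'. c' \<in> {a' + b', a' - b', a' * b'} \<and> c = h c'"
    using op by (auto simp: is_hom_def)
  then obtain c' where "c' \<in> {a' + b', a' - b', a' * b'}" "c = h c'" by blast
  then show ?case using slp.op[OF Y'(1) ab(1,2), of c'] Y'(2) by (intro exI[of _ "insert c' Y'"]) auto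
qed

section \<open>Counting operations\<close>

definition computes :: "'a::comm_ring_1 set \<Rightarrow> nat \<Rightarrow> 'a set \<Rightarrow> bool" where
  "computes X n H \<longleftrightarrow> (\<exists>Y. slp X n Y \<and> H \<subseteq> Y)"

lemma computes_refl: "H \<subseteq> X \<Longrightarrow> computes X n H"
  using slp.refl computes_def by blast

lemma computes_mono: "computes X n H \<Longrightarrow> X \<subseteq> X' \<Longrightarrow> n \<le> m \<Longrightarrow> H' \<subseteq> H \<Longrightarrow> computes X' m H'"
proof -
  assume a: "computes X n H" "X \<subseteq> X'" "n \<le> m" "H' \<subseteq> H"
  then obtain Y where Y: "slp X n Y" "H \<subseteq> Y" by (auto simp: computes_def)
  from slp_mono_steps[OF slp_Un[OF Y(1)] a(3), of X'] a(2) have "slp X' m (Y \<union> X')"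
    by (simp add: Un_absorb1)
  then show ?thesis using Y a by (auto simp: computes_def)
qed

text \<open>The second program may use the results of the first, so shared values are paid for only
  once.\<close>

lemma computes_trans:
  assumes "computes X n H" "computes (X \<union> H) m H'"
  shows "computes X (n + m) (H \<union> H')"
proof -
  obtain Y where Y: "slp X n Y" "H \<subseteq> Y" using assms by (auto simp: computes_def)
  then have "computes Y m H'" using slp_subset[OF Y(1)] by (intro computes_mono[OF assms(2)]) auto
  then obtain Z where Z: "slp Y m Z" "H' \<subseteq> Z" by (auto simp: computes_def)
  then show ?thesis using slp_trans[OF Z(1) Y(1)] Y Z slp_subset[OF Z(1)] by (auto simp: computes_def)
qed

lemma computes_Un: "computes X n H \<Longrightarrow> computes X m H' \<Longrightarrow> computes X (n + m) (H \<union> H')"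
  by (rule computes_trans) (auto intro: computes_mono)

lemma computes_UN:
  assumes "finite I" "\<And>i. i \<in> I \<Longrightarrow> computes X n (H i)"
  shows "computes X (n * card I) (\<Union>i\<in>I. H i)"
  using assms
proof (induction I rule: finite_induct)
  case (insert i I)
  then show ?case using computes_Un[of X n "H i" "n * card I" "\<Union>i\<in>I. H i"] by simp
qed (simp add: computes_refl)

lemma computes_op:
  assumes "computes X n {a}" "computes X m {b}" "c \<in> {a + b, a - b, a * b}"
  shows "computes X (n + m + 1) {c}"
proof -
  obtain Y where Y: "slp X (n + m) Y" "a \<in> Y" "b \<in> Y"
    using computes_Un[OF assms(1,2)] by (auto simp: computes_def)
  show ?thesis using slp.op[OF Y assms(3)] by (auto simp: computes_def)
qed

lemma computes_add: "computes X n {a} \<Longrightarrow> computes X m {b} \<Longrightarrow> computes X (n + m + 1) {a + b}"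
  by (rule computes_op) auto

lemma computes_diff: "computes X n {a} \<Longrightarrow> computes X m {b} \<Longrightarrow> computes X (n + m + 1) {a - b}"
  by (rule computes_op) auto

lemma computes_mult: "computes X n {a} \<Longrightarrow> computes X m {b} \<Longrightarrow> computes X (n + m + 1) {a * b}"
  by (rule computes_op) auto

lemma computes_sum:
  assumes "finite I" "\<And>i. i \<in> I \<Longrightarrow> computes X n {g i}" "0 \<in> X"
  shows "computes X ((n + 1) * card I) {sum g I}"
  using assms
proof (induction I rule: finite_induct)
  case (insert i I)
  then show ?case using computes_add[of X n "g i" "(n + 1) * card I" "sum g I"] by (simp add: add_ac)
qed (simp add: computes_refl)

lemma computes_prod:
  assumes "finite I" "I \<subseteq> X" "1 \<in> X"
  shows "computes X (card I) {\<Prod>I}"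
  using assms
proof (induction I rule: finite_induct)
  case (insert i I)
  then show ?case using computes_mult[of X 0 i "card I" "\<Prod>I"] by (simp add: computes_refl)
qed (simp add: computes_refl)

text \<open>Values are replaced by representations: \<open>R a u\<close> says that \<open>u\<close>
  represents \<open>a\<close>, and \<open>C u\<close> is the set of ring elements that store
  \<open>u\<close>. If one operation on representations costs \<open>k\<close>, then
  \<open>n\<close> operations cost \<open>k * n\<close>.\<close>

lemma slp_simulation:
  assumes "slp X n Y"
    and base: "\<And>a. a \<in> X \<Longrightarrow> \<exists>u. R a u \<and> C u \<subseteq> X'"
    and step: "\<And>a b c u v. R a u \<Longrightarrow> R b v \<Longrightarrow> c \<in> {a + b, a - b, a * b} \<Longrightarrow>
      \<exists>w. R c w \<and> computes (X' \<union> C u \<union> C v) k (C w)"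
  shows "\<exists>Y'. slp X' (k * n) Y' \<and> (\<forall>a\<in>Y. \<exists>u. R a u \<and> C u \<subseteq> Y')"
  using assms(1)
proof (induction rule: slp.induct)
  case (refl n)
  then show ?case using base slp.refl by blast
next
  case (op n Y a b c)
  then obtain Y' where Y': "slp X' (k * n) Y'" "\<forall>a\<in>Y. \<exists>u. R a u \<and> C u \<subseteq> Y'" by blast
  then obtain u v where uv: "R a u" "C u \<subseteq> Y'" "R b v" "C v \<subseteq> Y'" using op by blast
  obtain w where w: "R c w" "computes (X' \<union> C u \<union> C v) k (C w)"
    using step[OF uv(1,3) op.hyps(4)] by auto
  have "computes Y' k (C w)"
    using uv slp_subset[OF Y'(1)] by (intro computes_mono[OF w(2)]) auto
  then obtain Z where Z: "slp Y' k Z" "C w \<subseteq> Z" by (auto simp: computes_def)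
  have "slp X' (k * Suc n) Z" using slp_trans[OF Z(1) Y'(1)] by (simp add: add_ac)
  moreover have "\<forall>a\<in>insert c Y. \<exists>u. R a u \<and> C u \<subseteq> Z"
    using w Z Y'(2) slp_subset[OF Z(1)] by blast
  ultimately show ?case by blast
qed

text \<open>Horner's rule, with \<open>h\<close> carrying the scalars into the ring where the
  program runs.\<close>

lemma computes_poly:
  assumes "is_hom h" "h a \<in> X" "\<And>i. h (coeff P i) \<in> X"
  shows "\<exists>n. computes X n {h (poly P a)}"
  using assms(3)
proof (induction P)
  case 0
  have "h 0 = 0" using assms(1) unfolding is_hom_def by (metis add_cancel_right_right)
  then show ?case using 0[of 0] by (auto intro!: exI[of _ 0] computes_refl)
next
  case (pCons b P)
  have "h (coeff P i) \<in> X" for i using pCons.prems[of "Suc i"] by simp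
  then obtain n where n: "computes X n {h (poly P a)}" using pCons.IH by blast
  have "h b \<in> X" using pCons.prems[of 0] by simp
  then have "computes X (0 + (0 + n + 1) + 1) {h b + h a * h (poly P a)}"
    using n assms(2) by (intro computes_add computes_mult) (auto intro: computes_refl)
  then show ?case using assms(1) by (auto simp: is_hom_def)
qed

lemma computes_bounded:
  assumes "finite H" "\<And>h. h \<in> H \<Longrightarrow> \<exists>n. computes X n {h}"
  shows "\<exists>n. computes X n H"
  using assms
proof (induction H rule: finite_induct)
  case (insert h H)
  then obtain n m where "computes X n {h}" "computes X m H" by (meson insertCI)
  from computes_Un[OF this] show ?case by auto
qed (auto intro: computes_refl)

text \<open>Double and add along the binary digits: two operations per digit, and one more for
  \<open>0 = 1 - 1\<close>.\<close>

lemma computes_of_nat: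
  assumes "1 \<in> X" "k < 2 ^ n"
  shows "computes X (2 * n + 1) {of_nat k}"
  using assms(2)
proof (induction n arbitrary: k)
  case 0
  then show ?case using computes_diff[of X 0 1 0 1] assms by (simp add: computes_refl)
next
  case (Suc n)
  define j where "j = k div 2"
  have c: "computes X (2 * n + 1) {of_nat j}" using Suc by (auto simp: j_def)
  \<comment> \<open>Working from \<open>Y\<close>, where \<open>of_nat j\<close> is present, lets
    the doubling use it twice without computing it twice.\<close>
  then obtain Y where Y: "slp X (2 * n + 1) Y" "of_nat j \<in> Y" by (auto simp: computes_def)
  have j: "computes Y 0 {of_nat j}" "computes Y 0 {1}"
    using Y(2) slp_subset[OF Y(1)] assms(1) by (auto intro: computes_refl)
  have "of_nat k = (of_nat j + of_nat j :: 'a) \<or> of_nat k = (of_nat j + of_nat j + 1 :: 'a)"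
  proof -
    have "k = j + j \<or> k = j + j + 1" unfolding j_def by presburger
    then show ?thesis by (metis of_nat_add of_nat_1)
  qed
  moreover have "computes Y (0 + 0 + 1) {of_nat j + of_nat j}"
    by (intro computes_add j)
  then have "computes Y 2 {of_nat j + of_nat j}" by (rule computes_mono) auto
  moreover have "computes Y (0 + 0 + 1 + 0 + 1) {of_nat j + of_nat j + 1}"
    by (intro computes_add j)
  then have "computes Y 2 {of_nat j + of_nat j + 1}" by (rule computes_mono) auto
  ultimately have "computes Y 2 {of_nat k}" by metis
  then obtain Z where Z: "slp Y 2 Z" "of_nat k \<in> Z" by (auto simp: computes_def)
  show ?case using slp_trans[OF Z(1) Y(1)] Z(2) by (auto simp: computes_def)
qed

lemma computes_of_int:
  assumes "1 \<in> X"
  shows "\<exists>n. computes X n {of_int k}"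
proof -
  have *: "computes X (2 * m + 1) {of_nat m}" for m using computes_of_nat[OF assms] less_exp by blast
  have "computes X (1 + (2 * nat (- k) + 1) + 1) {0 - of_nat (nat (- k))}"
    using computes_diff[OF _ *] *[of 0] by (metis mult_0_right of_nat_0 add_0)
  with *[of "nat k"] show ?thesis by (cases "k \<ge> 0") auto
qed

section \<open>Comparison with the programs that define \<open>tau\<close>\<close>

lemma is_slp_slp:
  assumes "is_slp fs" "2 \<le> k" "k \<le> length fs"
  shows "slp {1, [:0, 1:]} (k - 2) (set (take k fs))"
  using assms(2,3)
proof (induction rule: dec_induct)
  case base
  have "take 2 fs = [fs ! 0, fs ! 1]" using assms by (cases fs; cases "tl fs") (auto simp: is_slp_def)
  then show ?case using assms(1) slp.refl[of "{1, [:0, 1:]}" 0] by (simp add: is_slp_def)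
next
  case (step k)
  obtain i j where ij: "i < k" "j < k" "fs ! k \<in> {fs ! i + fs ! j, fs ! i - fs ! j, fs ! i * fs ! j}"
    using assms(1) step.hyps step.prems unfolding is_slp_def by (metis Suc_le_lessD)
  have "fs ! i \<in> set (take k fs)" "fs ! j \<in> set (take k fs)"
    using ij step.prems by (simp_all add: in_set_conv_nth) fastforce+
  moreover have "slp {1, [:0, 1:]} (k - 2) (set (take k fs))" using step.IH step.prems by simp
  ultimately have "slp {1, [:0, 1:]} (Suc (k - 2)) (insert (fs ! k) (set (take k fs)))"
    using ij(3) slp.op by blast
  moreover have "Suc (k - 2) = Suc k - 2" using step.hyps(1) by simp
  ultimately show ?case using step.prems by (simp add: take_Suc_conv_app_nth)
qed

lemma is_slp_snoc:
  assumes "is_slp fs" "a \<in> set fs" "b \<in> set fs" "c \<in> {a + b, a - b, a * b}"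
  shows "is_slp (fs @ [c])"
proof -
  obtain k l where kl: "k < length fs" "l < length fs" "a = fs ! k" "b = fs ! l"
    using assms(2,3) by (metis in_set_conv_nth)
  have "\<exists>j<i. \<exists>k<i. (fs @ [c]) ! i \<in> {(fs @ [c]) ! j + (fs @ [c]) ! k,
      (fs @ [c]) ! j - (fs @ [c]) ! k, (fs @ [c]) ! j * (fs @ [c]) ! k}"
    if i: "2 \<le> i" "i < length (fs @ [c])" for i
  proof (cases "i = length fs")
    case True
    then show ?thesis using kl assms(4) by (intro exI[of _ k] exI[of _ l] conjI) (simp_all add: nth_append)
  next
    case False
    then have il: "i < length fs" using i by simp
    then obtain k l where "k < i" "l < i" "fs ! i \<in> {fs ! k + fs ! l, fs ! k - fs ! l, fs ! k * fs ! l}"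
      using assms(1) i(1) unfolding is_slp_def by metis
    then show ?thesis using il by (intro exI[of _ k] exI[of _ l] conjI) (simp_all add: nth_append)
  qed
  moreover have "length fs \<ge> 2" "fs ! 0 = 1" "fs ! 1 = [:0, 1:]" using assms(1) by (auto simp: is_slp_def)
  ultimately show ?thesis unfolding is_slp_def by (auto simp: nth_append)
qed

lemma slp_is_slp:
  "slp {1, [:0, 1:]} n Y \<Longrightarrow> \<exists>fs. is_slp fs \<and> set fs = Y \<and> length fs \<le> n + 2"
proof (induction rule: slp.induct)
  case (refl n)
  show ?case by (rule exI[of _ "[1, [:0, 1:]]"]) (auto simp: is_slp_def)
next
  case (op n Y a b c)
  then obtain fs where "is_slp fs" "set fs = Y" "length fs \<le> n + 2" by blast
  then show ?case using is_slp_snoc[of fs a b c] op by (intro exI[of _ "fs @ [c]"]) auto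
qed

text \<open>One more operation, \<open>f * 1\<close>, places \<open>f\<close> at the end of the
  list, where \<open>tau\<close> expects it.\<close>

lemma tau_le:
  assumes "computes {1, [:0, 1:]} n {f}"
  shows "tau f \<le> n + 1"
proof -
  obtain fs where fs: "is_slp fs" "f \<in> set fs" "length fs \<le> n + 2"
    using assms slp_is_slp by (fastforce simp: computes_def)
  have "1 \<in> set fs" using fs(1) by (auto simp: is_slp_def in_set_conv_nth intro!: exI[of _ 0])
  then have "is_slp (fs @ [f])" using is_slp_snoc[of fs f 1 f] fs by auto
  moreover have "length (fs @ [f]) = (length fs - 1) + 2" using fs(1) by (auto simp: is_slp_def)
  ultimately have "tau f \<le> length fs - 1" unfolding tau_def by (intro Least_le) (metis last_snoc)
  then show ?thesis using fs by simp
qed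

lemma is_hom_const: "is_hom (\<lambda>a. [:a:])" by (simp add: is_hom_def)

lemma int_poly_computable: "\<exists>n. computes {1, [:0, 1:]} n {f :: int poly}"
proof (induction f)
  case 0
  then show ?case using computes_of_int[of "{1, [:0, 1::int:]}" 0] by simp
next
  case (pCons a f)
  obtain n m where "computes {1, [:0, 1:]} n {f}" "computes {1, [:0, 1:]} m {of_int a :: int poly}"
    using pCons computes_of_int by blast
  then have "computes {1, [:0, 1:]} (m + (0 + n + 1) + 1) {of_int a + [:0, 1:] * f}"
    by (intro computes_add computes_mult) (simp_all add: computes_refl)
  then show ?case by (auto simp: of_int_poly)
qed

text \<open>Some program for \<open>f\<close> exists, so the \<open>LEAST\<close> in
  \<open>tau\<close> is attained by an actual list; a list of length \<open>tau f + 2\<close>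
  performs \<open>tau f\<close> operations.\<close>

lemma computes_tau: "computes {1, [:0, 1:]} (tau f) {f}"
proof -
  obtain n where "computes {1, [:0, 1:]} n {f}" using int_poly_computable by blast
  then obtain fs where fs: "is_slp fs" "f \<in> set fs"
    using slp_is_slp by (fastforce simp: computes_def)
  have "1 \<in> set fs" using fs(1) by (auto simp: is_slp_def in_set_conv_nth intro!: exI[of _ 0])
  then have "is_slp (fs @ [f])" using is_slp_snoc[of fs f 1 f] fs by auto
  moreover have "length (fs @ [f]) = (length fs - 1) + 2" using fs(1) by (auto simp: is_slp_def)
  ultimately have "\<exists>m fs. is_slp fs \<and> last fs = f \<and> length fs = m + 2" by (metis last_snoc)
  from LeastI_ex[OF this] obtain gs where gs: "is_slp gs" "last gs = f" "length gs = tau f + 2"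
    unfolding tau_def by blast
  have "slp {1, [:0, 1:]} (tau f) (set gs)" using is_slp_slp[OF gs(1), of "length gs"] gs(3) by simp
  moreover have "f \<in> set gs" using gs by (metis last_in_set list.size(3) zero_neq_numeral add_is_0)
  ultimately show ?thesis by (auto simp: computes_def)
qed

section \<open>Elimination of complex constants\<close>

lemma subring_op:
  assumes "is_subring K" "a \<in> K" "b \<in> K"
  shows "a + b \<in> K" "a - b \<in> K" "a * b \<in> K"
  using assms unfolding is_subring_def by blast+

lemma subring_0: "is_subring K \<Longrightarrow> 0 \<in> K"
  using subring_op(2)[of K 1 1] by (simp add: is_subring_def)

lemma subring_1: "is_subring K \<Longrightarrow> 1 \<in> K"
  by (simp add: is_subring_def)

lemma subring_of_nat: "is_subring K \<Longrightarrow> of_nat n \<in> K"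
proof (induction n)
  case (Suc n)
  then show ?case using subring_op(1)[of K 1 "of_nat n"] by (simp add: subring_1)
qed (simp add: subring_0)

lemma subring_of_int: "is_subring K \<Longrightarrow> of_int k \<in> K"
  using subring_of_nat subring_op(2)[OF _ subring_0 subring_of_nat]
  by (cases k rule: int_cases2) fastforce+

lemma subring_sum: "is_subring K \<Longrightarrow> (\<And>i. i \<in> I \<Longrightarrow> g i \<in> K) \<Longrightarrow> sum g I \<in> K"
proof (induction I rule: infinite_finite_induct)
  case (insert i I)
  then show ?case using subring_op(1)[of K "g i" "sum g I"] by simp
qed (simp_all add: subring_0)

lemma subring_power: "is_subring K \<Longrightarrow> a \<in> K \<Longrightarrow> a ^ n \<in> K"
  by (induction n) (auto simp: subring_op(3) subring_1)

lemma subring_range: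
  assumes "is_hom h" "h 1 = 1" "is_subring K"
  shows "is_subring (h ` K)"
proof -
  have "h a + h b \<in> h ` K \<and> h a - h b \<in> h ` K \<and> h a * h b \<in> h ` K" if "a \<in> K" "b \<in> K" for a b
    using that assms subring_op[OF assms(3) that] unfolding is_hom_def by (metis imageI)
  moreover have "1 \<in> h ` K" using assms by (metis imageI subring_1)
  ultimately show ?thesis unfolding is_subring_def by blast
qed

definition polys_over :: "'a::comm_ring_1 set \<Rightarrow> 'a poly set" where
  "polys_over K = {P. \<forall>i. coeff P i \<in> K}"

lemma subring_polys_over: "is_subring K \<Longrightarrow> is_subring (polys_over K)"
proof -
  assume K: "is_subring K"
  then have "coeff 1 i \<in> K" for i
    using subring_0[OF K] subring_1[OF K] by simp
  moreover have "coeff (a * b) i \<in> K" if "a \<in> polys_over K" "b \<in> polys_over K" for a b i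
    unfolding coeff_mult using K that by (intro subring_sum) (auto simp: polys_over_def intro: subring_op)
  ultimately show ?thesis using K unfolding is_subring_def[of "polys_over K"]
    by (auto simp: polys_over_def intro: subring_op)
qed

lemma const_in_polys_over: "is_subring K \<Longrightarrow> [:a:] \<in> polys_over K \<longleftrightarrow> a \<in> K"
  by (auto simp: polys_over_def coeff_pCons subring_0 split: nat.splits)

lemma pCons_in_polys_over: "pCons a P \<in> polys_over K \<longleftrightarrow> a \<in> K \<and> P \<in> polys_over K"
  by (auto simp: polys_over_def coeff_pCons split: nat.splits)

lemma poly_in_subring: "is_subring K \<Longrightarrow> P \<in> polys_over K \<Longrightarrow> a \<in> K \<Longrightarrow> poly P a \<in> K"
  by (induction P) (auto simp: subring_0 pCons_in_polys_over intro: subring_op)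

definition adjoin :: "'a::comm_ring_1 set \<Rightarrow> 'a \<Rightarrow> 'a set" where
  "adjoin K c = (\<lambda>P. poly P c) ` polys_over K"

lemma is_hom_poly: "is_hom (\<lambda>P. poly P c)"
  by (simp add: is_hom_def)

lemma subring_adjoin: "is_subring K \<Longrightarrow> is_subring (adjoin K c)"
  unfolding adjoin_def by (intro subring_range is_hom_poly subring_polys_over) simp_all

lemma insert_subset_adjoin:
  assumes "is_subring K"
  shows "insert c K \<subseteq> adjoin K c"
proof -
  have "[:0, 1:] \<in> polys_over K" "\<And>a. a \<in> K \<Longrightarrow> [:a:] \<in> polys_over K"
    using assms subring_0[OF assms] subring_0[OF subring_polys_over[OF assms]]
    by (auto simp: pCons_in_polys_over subring_1)
  then have "poly [:0, 1:] c \<in> adjoin K c" "\<And>a. a \<in> K \<Longrightarrow> poly [:a:] c \<in> adjoin K c"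
    unfolding adjoin_def by blast+
  then show ?thesis by auto
qed

section \<open>Eliminability of constants and the integer case\<close>

definition int_roots_subset :: "complex poly \<Rightarrow> complex poly \<Rightarrow> bool" where
  "int_roots_subset f g \<longleftrightarrow> (\<forall>k::int. poly f (of_int k) = 0 \<longrightarrow> poly g (of_int k) = 0)"

text \<open>The constant \<open>C\<close> depends on the inputs \<open>X\<close> alone and the loss
  is linear in the number of operations, so finitely many successive eliminations keep the bound
  linear.\<close>

definition eliminable :: "complex poly set \<Rightarrow> bool" where
  "eliminable X \<longleftrightarrow> (\<exists>C. \<forall>n f. f \<noteq> 0 \<longrightarrow> computes X n {f} \<longrightarrow>
     (\<exists>g::int poly. g \<noteq> 0 \<and> tau g \<le> C * (n + 1) \<and> int_roots_subset f (map_poly of_int g)))"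

definition with_consts :: "complex set \<Rightarrow> complex poly set" where
  "with_consts A = (\<lambda>a. [:a:]) ` A \<union> {1, [:0, 1:]}"

text \<open>Linear losses compose, and inclusion of integer zeros is transitive. Each single
  elimination step is proved in this form.\<close>

lemma eliminable_transfer:
  assumes "eliminable X'"
    and "\<And>n f. f \<noteq> 0 \<Longrightarrow> computes X n {f} \<Longrightarrow>
      \<exists>f'. f' \<noteq> 0 \<and> computes X' (k * (n + 1)) {f'} \<and> int_roots_subset f f'"
  shows "eliminable X"
proof -
  from assms(1) obtain C where C: "\<And>n f. f \<noteq> 0 \<Longrightarrow> computes X' n {f} \<Longrightarrow>
     (\<exists>g::int poly. g \<noteq> 0 \<and> tau g \<le> C * (n + 1) \<and> int_roots_subset f (map_poly of_int g))"
    unfolding eliminable_def by metis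
  have "\<exists>g::int poly. g \<noteq> 0 \<and> tau g \<le> (C * (k + 1)) * (n + 1) \<and> int_roots_subset f (map_poly of_int g)"
    if f: "f \<noteq> 0" "computes X n {f}" for n f
  proof -
    obtain f' where f': "f' \<noteq> 0" "computes X' (k * (n + 1)) {f'}" "int_roots_subset f f'"
      using assms(2)[OF f] by blast
    obtain g :: "int poly" where g: "g \<noteq> 0" "tau g \<le> C * (k * (n + 1) + 1)"
      "int_roots_subset f' (map_poly of_int g)" using C[OF f'(1,2)] by blast
    have "C * (k * (n + 1) + 1) \<le> C * ((k + 1) * (n + 1))" by (intro mult_le_mono2) simp
    then have "tau g \<le> (C * (k + 1)) * (n + 1)" using g(2) by (metis le_trans mult.assoc)
    then show ?thesis using g f'(3) unfolding int_roots_subset_def by blast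
  qed
  then show ?thesis unfolding eliminable_def by blast
qed

lemma is_hom_of_int_poly: "is_hom (map_poly of_int :: int poly \<Rightarrow> 'a::comm_ring_1 poly)"
  unfolding is_hom_def by (auto intro!: poly_eqI simp: coeff_map_poly coeff_mult of_int_sum)

lemma poly_map_of_int: "poly (map_poly of_int P) (of_int k) = of_int (poly P k)"
  by (induction P) (simp_all add: map_poly_pCons)

text \<open>The program lifts along the embedding of integer polynomials and so computes some
  \<open>g\<close> with image \<open>f\<close>; the finitely many integer constants cost a fixed
  number \<open>N\<close> of operations.\<close>

lemma eliminable_int:
  assumes "finite A" "A \<subseteq> range of_int"
  shows "eliminable (with_consts A)"
proof -
  let ?h = "map_poly of_int :: int poly \<Rightarrow> complex poly"
  obtain B where B: "finite B" "A = of_int ` B" using finite_subset_image[OF assms] by blast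
  define X where "X = (\<lambda>b. [:b:]) ` B \<union> {1, [:0, 1::int:]}"
  have X: "with_consts A = ?h ` X"
    by (auto simp: with_consts_def X_def B image_image image_Un map_poly_pCons)
  have "\<exists>N. computes {1, [:0, 1::int:]} N {[:b:]}" for b by (rule int_poly_computable)
  then obtain N where N: "computes {1, [:0, 1::int:]} N ((\<lambda>b. [:b:]) ` B)"
    using computes_bounded[of "(\<lambda>b. [:b:]) ` B" "{1, [:0, 1::int:]}"] B(1) by blast
  have "\<exists>g::int poly. g \<noteq> 0 \<and> tau g \<le> (N + 1) * (n + 1) \<and> int_roots_subset f (?h g)"
    if f: "f \<noteq> 0" "computes (with_consts A) n {f}" for n f
  proof -
    obtain Y where Y: "slp (?h ` X) n Y" "f \<in> Y" using f(2) X by (auto simp: computes_def)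
    obtain Y' where Y': "slp X n Y'" "Y = ?h ` Y'" using slp_lift[OF Y(1) is_hom_of_int_poly] by blast
    obtain g where g: "g \<in> Y'" "f = ?h g" using Y Y' by blast
    have "computes ({1, [:0, 1:]} \<union> (\<lambda>b. [:b:]) ` B) n {g}"
      using Y'(1) g(1) by (auto simp: computes_def X_def Un_commute)
    from computes_trans[OF N this] have "computes {1, [:0, 1:]} (N + n) {g}"
      by (rule computes_mono) auto
    then have "tau g \<le> (N + 1) * (n + 1)" using tau_le by fastforce
    then show ?thesis using g f(1) by (intro exI[of _ g]) (auto simp: int_roots_subset_def)
  qed
  then show ?thesis unfolding eliminable_def by blast
qed

text \<open>Elements of \<open>K[c]\<close> are polynomials in \<open>c\<close> over
  \<open>K\<close>, so finitely many such constants can be computed from \<open>c\<close> and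
  finitely many elements of \<open>K\<close> at a fixed cost.\<close>

lemma eliminable_adjoin:
  assumes K: "is_subring K" and step: "\<And>A. finite A \<Longrightarrow> A \<subseteq> K \<Longrightarrow> eliminable (with_consts (insert c A))"
    and A: "finite A" "A \<subseteq> adjoin K c"
  shows "eliminable (with_consts A)"
proof -
  have "\<forall>a\<in>A. \<exists>P. P \<in> polys_over K \<and> a = poly P c" using A(2) by (auto simp: adjoin_def)
  then obtain P where P: "\<And>a. a \<in> A \<Longrightarrow> P a \<in> polys_over K \<and> a = poly (P a) c" by metis
  \<comment> \<open>The 0 accounts for the coefficients beyond the degree, which
    \<open>coeffs\<close> omits.\<close>
  define B where "B = insert 0 (\<Union>a\<in>A. set (coeffs (P a)))"
  have B: "finite B" "B \<subseteq> K"
  proof -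
    have "set (coeffs (P a)) \<subseteq> K" if "a \<in> A" for a
    proof -
      have "range (coeff (P a)) \<subseteq> K" using P[OF that] by (auto simp: polys_over_def)
      then show ?thesis unfolding range_coeff by blast
    qed
    then show "B \<subseteq> K" using subring_0[OF K] unfolding B_def by blast
    show "finite B" using A(1) by (simp add: B_def)
  qed
  let ?X = "with_consts (insert c B)"
  have "\<exists>n. computes ?X n {[:a:]}" if a: "a \<in> A" for a
  proof -
    have "coeff (P a) i \<in> B" for i
    proof -
      have "coeff (P a) i \<in> insert 0 (set (coeffs (P a)))" unfolding range_coeff[symmetric] by simp
      then show ?thesis using a unfolding B_def by blast
    qed
    then have "\<exists>n. computes ?X n {[:poly (P a) c:]}"
      by (intro computes_poly[where h = "\<lambda>a. [:a:]"] is_hom_const) (auto simp: with_consts_def)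
    then show ?thesis using P[OF a] by simp
  qed
  then obtain N where N: "computes ?X N ((\<lambda>a. [:a:]) ` A)"
    using computes_bounded[of "(\<lambda>a. [:a:]) ` A" ?X] A(1) by blast
  show ?thesis
  proof (rule eliminable_transfer[OF step[OF B], of _ "N + 1"])
    fix n f assume f: "f \<noteq> 0" "computes (with_consts A) n {f :: complex poly}"
    have "computes (?X \<union> (\<lambda>a. [:a:]) ` A) n {f}"
      using f(2) by (rule computes_mono) (auto simp: with_consts_def)
    from computes_trans[OF N this] have "computes ?X ((N + 1) * (n + 1)) {f}"
      by (rule computes_mono) auto
    then show "\<exists>f'. f' \<noteq> 0 \<and> computes ?X ((N + 1) * (n + 1)) {f'} \<and> int_roots_subset f f'"
      using f(1) by (auto simp: int_roots_subset_def)
  qed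
qed

section \<open>Transcendental constants\<close>

lemma slp_degree:
  assumes "slp X n Y" "\<And>P. P \<in> X \<Longrightarrow> degree P \<le> 1" "P \<in> Y"
  shows "degree (P :: 'a::comm_ring_1 poly) \<le> 2 ^ n"
  using assms(1,3)
proof (induction arbitrary: P rule: slp.induct)
  case (refl n)
  then show ?case using assms(2)[of P] one_le_power[of "2::nat" n] by linarith
next
  case (op n Y a b c)
  have a: "degree a \<le> 2 ^ n" and b: "degree b \<le> 2 ^ n" using op.IH op.hyps(2,3) by blast+
  have "degree (a + b) \<le> 2 ^ n" "degree (a - b) \<le> 2 ^ n" "degree (a * b) \<le> 2 ^ n + 2 ^ n"
    using a b degree_mult_le[of a b] by (simp_all add: degree_add_le degree_diff_le)
  then have c: "degree c \<le> 2 ^ Suc n" using op.hyps(4) by fastforce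
  show ?case
  proof (cases "P = c")
    case False
    then have "degree P \<le> 2 ^ n" using op.IH op.prems by blast
    then show ?thesis by simp
  qed (use c in simp)
qed

text \<open>The outer variable of \<open>F\<close> stands for a constant to be eliminated, the inner
  one is the original indeterminate; substitutions for the two commute.\<close>

lemma poly_poly_const:
  "poly (poly F [:a:]) z = poly (map_poly (\<lambda>q. poly q z) F) (a :: 'a::comm_ring_1)"
  by (induction F) (simp_all add: map_poly_pCons)

lemma map_poly_eval_in_polys_over:
  assumes "is_subring K" "F \<in> polys_over (polys_over K)" "z \<in> K"
  shows "map_poly (\<lambda>q. poly q z) F \<in> polys_over K"
proof -
  have "poly (coeff F i) z \<in> K" for i
    using assms by (intro poly_in_subring) (auto simp: polys_over_def[of "polys_over K"])
  then show ?thesis by (simp add: polys_over_def coeff_map_poly)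
qed

lemma ex_nonroot:
  fixes F :: "complex poly poly"
  assumes "F \<noteq> 0" "degree F < m"
  shows "\<exists>t<m. poly F [:of_nat t:] \<noteq> 0"
proof (rule ccontr)
  assume "\<not> ?thesis"
  then have "(\<lambda>t. [:of_nat t:]) ` {..<m} \<subseteq> {q. poly F q = 0}" by auto
  then have "card ((\<lambda>t. [:of_nat t :: complex:]) ` {..<m}) \<le> degree F"
    using card_poly_roots_bound[OF assms(1)] poly_roots_finite[OF assms(1)] by (meson card_mono le_trans)
  moreover have "card ((\<lambda>t. [:of_nat t :: complex:]) ` {..<m}) = m"
    by (subst card_image) (auto simp: inj_on_def)
  ultimately show False using assms(2) by simp
qed

text \<open>The transcendental constant becomes an indeterminate, which is then specialised to an integer
  small enough to be computed in linearly many steps.\<close>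

lemma eliminable_transcendental:
  assumes K: "is_subring K" "A \<subseteq> K" and elim: "eliminable (with_consts A)"
    and c: "\<And>P. P \<in> polys_over K \<Longrightarrow> poly P c = 0 \<Longrightarrow> P = 0"
  shows "eliminable (with_consts (insert c A))"
proof (rule eliminable_transfer[OF elim, of _ 4])
  fix n f assume f: "f \<noteq> 0" "computes (with_consts (insert c A)) n {f :: complex poly}"
  \<comment> \<open>\<open>[:[:0, 1:]:]\<close> is the original indeterminate and
    \<open>[:0, 1:]\<close> the new one; the evaluation \<open>?ev c\<close> turns these inputs into
    the given ones.\<close>
  define X :: "complex poly poly set" where "X = (\<lambda>a. [:[:a:]:]) ` A \<union> {1, [:[:0, 1:]:], [:0, 1:]}"
  let ?ev = "\<lambda>a F. poly F [:a :: complex:]"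
  have ev: "?ev a ` X = insert [:a:] (with_consts A)" for a
    by (auto simp: X_def with_consts_def image_Un image_image)
  have "insert [:c:] (with_consts A) = with_consts (insert c A)" by (auto simp: with_consts_def)
  then obtain Y where Y: "slp (?ev c ` X) n Y" "f \<in> Y" using f(2) ev by (auto simp: computes_def)
  obtain Z where Z: "slp X n Z" "Y = ?ev c ` Z" using slp_lift[OF Y(1) is_hom_poly] by blast
  obtain F where F: "F \<in> Z" "f = ?ev c F" using Y Z by blast
  \<comment> \<open>The degree may be exponential in \<open>n\<close>, yet a suitable
    \<open>t\<close> below \<open>2 ^ (n + 1)\<close> has at most \<open>n + 1\<close> binary digits
    and is cheap to compute.\<close>
  have "degree F \<le> 2 ^ n"
    by (rule slp_degree[OF Z(1) _ F(1)]) (auto simp: X_def)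
  also have "(2::nat) ^ n < 2 ^ (n + 1)" by simp
  finally have "degree F < 2 ^ (n + 1)" .
  moreover have "F \<noteq> 0" using F f by auto
  ultimately obtain t where t: "t < 2 ^ (n + 1)" "?ev (of_nat t) F \<noteq> 0" using ex_nonroot by blast
  have "X \<subseteq> polys_over (polys_over K)"
    using K subring_0[OF K(1)]
    by (auto simp: X_def pCons_in_polys_over const_in_polys_over subring_polys_over subring_0 subring_1
        one_pCons)
  then have FK: "F \<in> polys_over (polys_over K)"
    using slp_subring[OF Z(1) subring_polys_over[OF subring_polys_over[OF K(1)]]] F(1) by blast
  have "slp (insert [:of_nat t:] (with_consts A)) n (?ev (of_nat t) ` Z)"
    using slp_hom[OF Z(1) is_hom_poly, of "[:of_nat t:]"] ev by simp
  then have "computes (with_consts A \<union> {of_nat t}) n {?ev (of_nat t) F}"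
    using F(1) by (auto simp: computes_def of_nat_poly)
  moreover have "computes (with_consts A) (2 * (n + 1) + 1) {of_nat t}"
    using t(1) by (intro computes_of_nat) (auto simp: with_consts_def)
  ultimately have "computes (with_consts A) (2 * (n + 1) + 1 + n) ({of_nat t} \<union> {?ev (of_nat t) F})"
    by (rule computes_trans[rotated])
  then have "computes (with_consts A) (4 * (n + 1)) {?ev (of_nat t) F}"
    by (rule computes_mono) auto
  moreover have "int_roots_subset f (?ev (of_nat t) F)"
    unfolding int_roots_subset_def
  proof (intro allI impI)
    fix k :: int assume "poly f (of_int k) = 0"
    then have "poly (map_poly (\<lambda>q. poly q (of_int k)) F) c = 0" using F(2) by (simp add: poly_poly_const)
    \<comment> \<open>Specialising the inner variable to \<open>k\<close> gives a polynomial over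
      \<open>K\<close> that vanishes at \<open>c\<close>; transcendence makes it zero, so it
      vanishes at \<open>t\<close> too.\<close>
    then have "map_poly (\<lambda>q. poly q (of_int k)) F = 0"
      using c map_poly_eval_in_polys_over[OF K(1) FK] subring_of_int[OF K(1)] by blast
    then show "poly (?ev (of_nat t) F) (of_int k) = 0" by (simp add: poly_poly_const)
  qed
  ultimately show "\<exists>f'. f' \<noteq> 0 \<and> computes (with_consts A) (4 * (n + 1)) {f'} \<and> int_roots_subset f f'"
    using t(2) by blast
qed

section \<open>Algebraic constants\<close>

lemma poly_as_sum:
  fixes Q :: "'a::idom poly"
  assumes "degree Q < d"
  shows "poly Q c = (\<Sum>t<d. coeff Q t * c ^ t)"
proof -
  have "poly Q c = (\<Sum>t\<le>degree Q. coeff Q t * c ^ t)" by (simp add: poly_altdef)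
  also have "\<dots> = (\<Sum>t<d. coeff Q t * c ^ t)"
    using assms by (intro sum.mono_neutral_left) (auto simp: coeff_eq_0)
  finally show ?thesis .
qed

text \<open>The powers of \<open>c\<close> below the minimal degree \<open>d\<close> of a relation
  over \<open>K\<close> serve as a basis. The leading coefficient \<alpha> of a minimal relation
  need not be invertible in \<open>K\<close>, so higher powers are expressed only after
  multiplication by a common denominator \<beta>.\<close>

lemma algebraic_relations:
  fixes K :: "'a::idom set"
  assumes K: "is_subring K" and P: "P \<in> polys_over K" "P \<noteq> 0" "poly P c = 0"
  obtains d \<beta> M where "d \<ge> 1" "\<beta> \<in> K" "\<beta> \<noteq> 0" "\<forall>l t. M l t \<in> K"
    "\<forall>l<2 * d. \<beta> * c ^ l = (\<Sum>t<d. M l t * c ^ t)"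
    "\<forall>v. (\<forall>t. v t \<in> K) \<longrightarrow> (\<Sum>t<d. v t * c ^ t) = 0 \<longrightarrow> (\<forall>t<d. v t = 0)"
proof -
  obtain P where P: "P \<in> polys_over K" "P \<noteq> 0" "poly P c = 0"
    and min: "\<And>Q. Q \<in> polys_over K \<Longrightarrow> Q \<noteq> 0 \<Longrightarrow> poly Q c = 0 \<Longrightarrow> degree P \<le> degree Q"
    using arg_min_nat_lemma[of "\<lambda>Q. Q \<in> polys_over K \<and> Q \<noteq> 0 \<and> poly Q c = 0" P degree] P by blast
  define d where "d = degree P"
  define \<alpha> where "\<alpha> = lead_coeff P"
  have \<alpha>: "\<alpha> \<in> K" "\<alpha> \<noteq> 0" using P by (auto simp: polys_over_def \<alpha>_def)
  have d: "d \<ge> 1"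
  proof (rule ccontr)
    assume "\<not> ?thesis"
    then obtain a where "P = [:a:]" unfolding d_def by (metis degree_eq_zeroE less_one not_le)
    then show False using P by simp
  qed
  have "\<exists>Q. Q \<in> polys_over K \<and> degree Q < d \<and> \<alpha> ^ l * c ^ l = poly Q c" for l
  proof (induction l)
    case 0
    then show ?case using d subring_polys_over[OF K] by (intro exI[of _ 1]) (simp add: subring_1)
  next
    case (Suc l)
    then obtain Q where Q: "Q \<in> polys_over K" "degree Q < d" "\<alpha> ^ l * c ^ l = poly Q c" by blast
    \<comment> \<open>Pseudo-division: multiply by \<alpha> and \<open>c\<close>, then subtract the
      multiple of \<open>P\<close> that cancels the coefficient of degree \<open>d\<close>.\<close>
    define R where "R = smult \<alpha> (pCons 0 Q) - smult (coeff Q (d - 1)) P"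
    have "R \<in> polys_over K"
      using Q(1) P(1) \<alpha> K subring_0[OF K]
      by (auto simp: R_def polys_over_def coeff_pCons subring_op split: nat.splits)
    moreover have "degree R \<le> d - 1"
    proof (rule degree_le, intro allI impI)
      fix i assume i: "d - 1 < i"
      then obtain j where j: "i = Suc j" by (cases i) auto
      show "coeff R i = 0"
      proof (cases "i = d")
        case True
        then have "coeff P (Suc j) = \<alpha>" "d - 1 = j" using j by (simp_all add: \<alpha>_def d_def)
        then show ?thesis unfolding j by (simp add: R_def)
      next
        case False
        then have "i > d" using i by simp
        then show ?thesis using j Q(2) by (simp add: R_def coeff_eq_0 d_def)
      qed
    qed
    then have "degree R < d" using d by simp
    moreover have "\<alpha> ^ Suc l * c ^ Suc l = poly R c" using Q(3) P(3) by (simp add: R_def mult_ac)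
    ultimately show ?case by blast
  qed
  then obtain Q where Q: "\<And>l. Q l \<in> polys_over K" "\<And>l. degree (Q l) < d"
    "\<And>l. \<alpha> ^ l * c ^ l = poly (Q l) c" by metis
  \<comment> \<open>The missing factors \<alpha> are supplied so that all \<open>l < 2 * d\<close>
    share one denominator; products of two basis elements have exponents in this range.\<close>
  define M where "M l t = \<alpha> ^ (2 * d - l) * coeff (Q l) t" for l t
  show ?thesis
  proof (rule that[OF d, of "\<alpha> ^ (2 * d)" M])
    show "\<alpha> ^ (2 * d) \<in> K" "\<alpha> ^ (2 * d) \<noteq> 0" using \<alpha> K by (auto intro: subring_power)
    show "\<forall>l t. M l t \<in> K"
    proof (intro allI)
      fix l t
      have "coeff (Q l) t \<in> K" using Q(1)[of l] by (simp add: polys_over_def)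
      then show "M l t \<in> K" unfolding M_def by (intro subring_op(3) K subring_power \<alpha>)
    qed
    show "\<forall>l<2 * d. \<alpha> ^ (2 * d) * c ^ l = (\<Sum>t<d. M l t * c ^ t)"
    proof (intro allI impI)
      fix l assume "l < 2 * d"
      then have "\<alpha> ^ (2 * d) * c ^ l = \<alpha> ^ (2 * d - l) * (\<alpha> ^ l * c ^ l)"
        by (simp add: mult.assoc[symmetric] power_add[symmetric])
      also have "\<dots> = (\<Sum>t<d. M l t * c ^ t)"
        by (simp add: Q(3) poly_as_sum[OF Q(2)] M_def sum_distrib_left mult_ac)
      finally show "\<alpha> ^ (2 * d) * c ^ l = (\<Sum>t<d. M l t * c ^ t)" .
    qed
    show "\<forall>v. (\<forall>t. v t \<in> K) \<longrightarrow> (\<Sum>t<d. v t * c ^ t) = 0 \<longrightarrow> (\<forall>t<d. v t = 0)"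
    proof (intro allI impI)
      fix v t assume v: "\<forall>t. v t \<in> K" "(\<Sum>t<d. v t * c ^ t) = 0" and t: "t < d"
      \<comment> \<open>A dependence would be a relation of degree below \<open>d\<close>, against
        minimality.\<close>
      define R where "R = (\<Sum>t<d. monom (v t) t)"
      have coeff_R: "coeff R i = (if i < d then v i else 0)" for i
        by (simp add: R_def coeff_sum)
      have "R \<in> polys_over K" using v(1) subring_0[OF K] by (simp add: polys_over_def coeff_R)
      moreover have "poly R c = 0" using v(2) by (simp add: R_def poly_sum poly_monom)
      moreover have "degree R < d"
        using d by (intro le_less_trans[OF degree_le[of "d - 1"]]) (auto simp: coeff_R)
      ultimately have "R = 0" using min[of R] by (auto simp: d_def)
      then show "v t = 0" using coeff_R[of t] t by simp
    qed
  qed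
qed

lemma smult_sum_right: "smult a (sum f I) = (\<Sum>i\<in>I. smult a (f i))"
  by (induction I rule: infinite_finite_induct) (simp_all add: smult_add_right)

text \<open>A polynomial \<open>f\<close> over \<open>K[c]\<close> is represented by a denominator \<open>\<delta> \<in> K\<close> and the coordinates of
  \<open>\<delta> f\<close> with respect to the powers of \<open>c\<close>; \<open>M\<close> are the structure constants.\<close>

lemma eliminable_algebraic:
  assumes K: "is_subring K" and A: "finite A" "A \<subseteq> K"
    and elim: "\<And>A. finite A \<Longrightarrow> A \<subseteq> K \<Longrightarrow> eliminable (with_consts A)"
    and P: "P \<in> polys_over K" "P \<noteq> 0" "poly P c = 0"
  shows "eliminable (with_consts (insert c A))"
proof -
  obtain d \<beta> M where d: "d \<ge> 1" and \<beta>: "\<beta> \<in> K" "\<beta> \<noteq> 0" and M: "\<forall>l t. M l t \<in> K"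
    and rel: "\<forall>l<2 * d. \<beta> * c ^ l = (\<Sum>t<d. M l t * c ^ t)"
    and indep: "\<forall>v. (\<forall>t. v t \<in> K) \<longrightarrow> (\<Sum>t<d. v t * c ^ t) = 0 \<longrightarrow> (\<forall>t<d. v t = 0)"
    by (rule algebraic_relations[OF K P]) (rule that)
  define B where "B = A \<union> {0, \<beta>} \<union> (\<lambda>(l, t). M l t) ` ({..<2 * d} \<times> {..<d})"
  have B: "finite B" "B \<subseteq> K" using A \<beta> M subring_0[OF K] by (auto simp: B_def)
  define X where "X = with_consts B"
  have BX: "[:b:] \<in> X" if "b \<in> B" for b using that unfolding X_def with_consts_def by blast
  have "M l t \<in> B" if "l < 2 * d" "t < d" for l t
    unfolding B_def using that by (intro UnI2 image_eqI[of _ _ "(l, t)"]) auto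
  then have X: "[:\<beta>:] \<in> X" "0 \<in> X" "1 \<in> X" "[:0, 1:] \<in> X" "\<And>a. a \<in> A \<Longrightarrow> [:a:] \<in> X"
      "\<And>l t. l < 2 * d \<Longrightarrow> t < d \<Longrightarrow> [:M l t:] \<in> X"
    using BX[of \<beta>] BX[of 0] BX by (simp_all add: B_def X_def with_consts_def)
  define R :: "complex poly \<Rightarrow> complex \<times> (nat \<Rightarrow> complex poly) \<Rightarrow> bool" where
    "R = (\<lambda>f (\<delta>, v). \<delta> \<in> K \<and> \<delta> \<noteq> 0 \<and> (\<forall>t. v t \<in> polys_over K) \<and>
      smult \<delta> f = (\<Sum>t<d. smult (c ^ t) (v t)))"
  define S :: "complex \<times> (nat \<Rightarrow> complex poly) \<Rightarrow> complex poly set" where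
    "S = (\<lambda>(\<delta>, v). insert [:\<delta>:] (v ` {..<d}))"
  \<comment> \<open>A sum costs at most 3 for the denominator and 3 for each of the \<open>d\<close>
    coordinates; in a product each coordinate has \<open>d * d\<close> terms of cost 3. The constant
    \<open>k\<close> covers both cases.\<close>
  define k where "k = 3 + (3 + 3 * (d * d)) * d"
  have KK: "is_subring (polys_over K)" by (rule subring_polys_over[OF K])
  have base: "\<exists>u. R f u \<and> S u \<subseteq> X" if "f \<in> with_consts (insert c A)" for f
  proof (cases "f = [:c:]")
    case True
    \<comment> \<open>The relation for \<open>l = 1\<close> represents \<open>c\<close> itself; it
      is available even when \<open>d = 1\<close>, since the relations reach up to
      \<open>2 * d - 1\<close>.\<close>
    have "R f (\<beta>, \<lambda>t. [:M 1 t:])"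
      using True \<beta> M rel[rule_format, of 1] d
      by (simp add: R_def const_in_polys_over[OF K] smult_pCons sum_to_poly mult_ac)
    moreover have "S (\<beta>, \<lambda>t. [:M 1 t:]) \<subseteq> X" using X d by (auto simp: S_def)
    ultimately show ?thesis by blast
  next
    case False
    then have f: "f \<in> X" "f \<in> polys_over K"
      using that X A K subring_0[OF K] subring_0[OF KK] unfolding with_consts_def
      by (auto simp: pCons_in_polys_over subring_1 one_pCons)
    have "(\<Sum>t<d. smult (c ^ t) (if t = 0 then f else 0)) = (\<Sum>t<d. if t = 0 then f else 0)"
      by (intro sum.cong) auto
    then have "R f (1, \<lambda>t. if t = 0 then f else 0)"
      using f K d subring_0[OF KK] by (simp add: R_def subring_1)
    moreover have "S (1, \<lambda>t. if t = 0 then f else 0) \<subseteq> X" using f X by (auto simp: S_def one_pCons[symmetric])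
    ultimately show ?thesis by blast
  qed
  have step: "\<exists>w. R h w \<and> computes (X \<union> S u \<union> S u') k (S w)"
    if R: "R f u" "R g u'" and h: "h \<in> {f + g, f - g, f * g}" for f g h u u'
  proof -
    obtain \<delta> v \<delta>' v' where u: "u = (\<delta>, v)" "u' = (\<delta>', v')" by (cases u, cases u')
    have \<delta>: "\<delta> \<in> K" "\<delta> \<noteq> 0" "\<delta>' \<in> K" "\<delta>' \<noteq> 0" and v: "\<And>t. v t \<in> polys_over K" "\<And>t. v' t \<in> polys_over K"
      and f: "smult \<delta> f = (\<Sum>t<d. smult (c ^ t) (v t))" and g: "smult \<delta>' g = (\<Sum>t<d. smult (c ^ t) (v' t))"
      using R by (auto simp: R_def u)
    let ?X = "X \<union> S u \<union> S u'"
    have c0: "computes ?X 0 {[:\<delta>:]}" "computes ?X 0 {[:\<delta>':]}" "computes ?X 0 {[:\<beta>:]}"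
      "\<And>t. t < d \<Longrightarrow> computes ?X 0 {v t}" "\<And>t. t < d \<Longrightarrow> computes ?X 0 {v' t}"
      "\<And>l t. l < 2 * d \<Longrightarrow> t < d \<Longrightarrow> computes ?X 0 {[:M l t:]}"
      using X by (auto simp: S_def u intro: computes_refl)
    have \<delta>K: "[:\<delta>:] \<in> polys_over K" "[:\<delta>':] \<in> polys_over K" using \<delta> by (simp_all add: const_in_polys_over K)
    have "computes ?X (0 + 0 + 1) {[:\<delta>:] * [:\<delta>':]}" by (intro computes_mult c0)
    then have den: "computes ?X 3 {[:\<delta> * \<delta>':]}" by (simp add: computes_mono)
    have linear: "\<exists>w. R h w \<and> computes ?X k (S w)"
      if w: "smult (\<delta> * \<delta>') h = (\<Sum>t<d. smult (c ^ t) (w t))" "\<And>t. w t \<in> polys_over K"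
        and cw: "\<And>t. t < d \<Longrightarrow> computes ?X 3 {w t}" for w h
    proof -
      have "R h (\<delta> * \<delta>', w)" using \<delta> w by (simp add: R_def subring_op K)
      moreover have "computes ?X (3 + 3 * card {..<d}) ({[:\<delta> * \<delta>':]} \<union> (\<Union>t\<in>{..<d}. {w t}))"
        using cw by (intro computes_Un computes_UN den) auto
      then have "computes ?X k (S (\<delta> * \<delta>', w))"
        by (rule computes_mono) (auto simp: k_def S_def)
      ultimately show ?thesis by blast
    qed
    consider "h = f + g" | "h = f - g" | "h = f * g" using h by blast
    then show ?thesis
    proof cases
      case 1
      have "smult (\<delta> * \<delta>') h = smult \<delta>' (smult \<delta> f) + smult \<delta> (smult \<delta>' g)"
        by (simp add: 1 smult_add_right mult_ac)
      also have "\<dots> = (\<Sum>t<d. smult (c ^ t) ([:\<delta>':] * v t + [:\<delta>:] * v' t))"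
        unfolding f g by (simp add: smult_sum_right sum.distrib smult_add_right mult_ac)
      finally show ?thesis
      proof (rule linear)
        show "[:\<delta>':] * v t + [:\<delta>:] * v' t \<in> polys_over K" for t by (intro subring_op KK \<delta>K v)
        show "computes ?X 3 {[:\<delta>':] * v t + [:\<delta>:] * v' t}" if "t < d" for t
        proof -
          have "computes ?X (0 + 0 + 1 + (0 + 0 + 1) + 1) {[:\<delta>':] * v t + [:\<delta>:] * v' t}"
            by (intro computes_add computes_mult c0 that)
          then show ?thesis by (rule computes_mono) auto
        qed
      qed
    next
      case 2
      have "smult (\<delta> * \<delta>') h = smult \<delta>' (smult \<delta> f) - smult \<delta> (smult \<delta>' g)"
        by (simp add: 2 smult_diff_right mult_ac)
      also have "\<dots> = (\<Sum>t<d. smult (c ^ t) ([:\<delta>':] * v t - [:\<delta>:] * v' t))"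
        unfolding f g by (simp add: smult_sum_right sum_subtractf smult_diff_right mult_ac)
      finally show ?thesis
      proof (rule linear)
        show "[:\<delta>':] * v t - [:\<delta>:] * v' t \<in> polys_over K" for t by (intro subring_op KK \<delta>K v)
        show "computes ?X 3 {[:\<delta>':] * v t - [:\<delta>:] * v' t}" if "t < d" for t
        proof -
          have "computes ?X (0 + 0 + 1 + (0 + 0 + 1) + 1) {[:\<delta>':] * v t - [:\<delta>:] * v' t}"
            by (intro computes_diff computes_mult c0 that)
          then show ?thesis by (rule computes_mono) auto
        qed
      qed
    next
      case 3
      \<comment> \<open>Expanding \<open>\<beta> * c ^ (i + j)\<close> by the structure constants
        gives the coordinates of the product, at the price of a factor \<beta> in the
        denominator.\<close>
      define w where "w t = (\<Sum>(i, j)\<in>{..<d} \<times> {..<d}. v i * v' j * [:M (i + j) t:])" for t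
      have "smult (\<delta> * \<delta>' * \<beta>) h = smult \<beta> (smult \<delta> f * smult \<delta>' g)"
        by (simp add: 3 mult_ac)
      also have "\<dots> = (\<Sum>(i, j)\<in>{..<d} \<times> {..<d}. smult (\<beta> * c ^ (i + j)) (v i * v' j))"
        unfolding f g sum_product sum.cartesian_product smult_sum_right case_prod_unfold
        by (simp add: power_add mult_ac)
      also have "\<dots> = (\<Sum>(i, j)\<in>{..<d} \<times> {..<d}. \<Sum>t<d. smult (c ^ t) (v i * v' j * [:M (i + j) t:]))"
        by (intro sum.cong) (auto simp: rel smult_sum mult_ac)
      also have "\<dots> = (\<Sum>t<d. smult (c ^ t) (w t))"
        unfolding w_def smult_sum_right case_prod_unfold by (rule sum.swap)
      finally have eq: "smult (\<delta> * \<delta>' * \<beta>) h = (\<Sum>t<d. smult (c ^ t) (w t))" .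
      have "w t \<in> polys_over K" for t
        unfolding w_def case_prod_unfold using M v
        by (intro subring_sum subring_op KK) (auto simp: const_in_polys_over K)
      then have "R h (\<delta> * \<delta>' * \<beta>, w)" using \<delta> \<beta> eq by (simp add: R_def subring_op K)
      moreover have "computes ?X (3 * (d * d)) {w t}" if "t < d" for t
      proof -
        have "computes ?X ((0 + 0 + 1 + 0 + 1 + 1) * card ({..<d} \<times> {..<d})) {w t}"
          unfolding w_def case_prod_unfold using that X(2)
          by (intro computes_sum computes_mult c0) auto
        then show ?thesis by (rule computes_mono) (simp_all add: card_cartesian_product)
      qed
      then have "computes ?X (0 + 0 + 1 + 0 + 1 + 3 * (d * d) * card {..<d})
          ({[:\<delta>:] * [:\<delta>':] * [:\<beta>:]} \<union> (\<Union>t\<in>{..<d}. {w t}))"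
        by (intro computes_Un computes_UN computes_mult c0) auto
      then have "computes ?X k (S (\<delta> * \<delta>' * \<beta>, w))"
        by (rule computes_mono) (auto simp: k_def S_def algebra_simps)
      ultimately show ?thesis by blast
    qed
  qed
  show ?thesis
  proof (rule eliminable_transfer[OF elim[OF B], of _ k])
    fix n f assume f: "f \<noteq> 0" "computes (with_consts (insert c A)) n {f :: complex poly}"
    then obtain Y where Y: "slp (with_consts (insert c A)) n Y" "f \<in> Y" by (auto simp: computes_def)
    have "\<exists>Y'. slp X (k * n) Y' \<and> (\<forall>a\<in>Y. \<exists>u. R a u \<and> S u \<subseteq> Y')"
      by (rule slp_simulation[OF Y(1)]) (rule base step; assumption)+
    then obtain Y' where Y': "slp X (k * n) Y'" "\<forall>a\<in>Y. \<exists>u. R a u \<and> S u \<subseteq> Y'" by blast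
    then obtain \<delta> v where R: "R f (\<delta>, v)" and S: "S (\<delta>, v) \<subseteq> Y'" using Y(2) by (metis surj_pair)
    have v: "\<And>t. v t \<in> polys_over K" "smult \<delta> f = (\<Sum>t<d. smult (c ^ t) (v t))" "\<delta> \<noteq> 0"
      using R by (auto simp: R_def)
    have "(\<Sum>t<d. smult (c ^ t) (v t)) \<noteq> 0" using v f(1) by (metis smult_eq_0_iff)
    \<comment> \<open>Since \<delta> f is nonzero, one of its coordinates is; this coordinate
      replaces \<open>f\<close>.\<close>
    then obtain t where t: "t < d" "v t \<noteq> 0" by (metis (no_types, lifting) lessThan_iff smult_0_right sum.neutral)
    have "computes X (k * n) {v t}" using Y'(1) S t(1) by (auto simp: computes_def S_def)
    then have "computes X (k * (n + 1)) {v t}" by (rule computes_mono) auto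
    moreover have "int_roots_subset f (v t)"
      unfolding int_roots_subset_def
    proof (intro allI impI)
      fix z :: int assume "poly f (of_int z) = 0"
      then have "poly (smult \<delta> f) (of_int z) = 0" by simp
      then have "(\<Sum>t<d. poly (v t) (of_int z) * c ^ t) = 0" by (simp add: v(2) poly_sum mult_ac)
      moreover have "poly (v t) (of_int z) \<in> K" for t
        using v(1) by (intro poly_in_subring K subring_of_int)
      \<comment> \<open>At an integer \<open>z\<close> all coordinates take values in
        \<open>K\<close>, so at a zero of \<open>f\<close> independence forces each of them to
        vanish.\<close>
      ultimately show "poly (v t) (of_int z) = 0" using indep[rule_format, of "\<lambda>t. poly (v t) (of_int z)" t] t(1) by blast
    qed
    ultimately show "\<exists>f'. f' \<noteq> 0 \<and> computes (with_consts B) (k * (n + 1)) {f'} \<and> int_roots_subset f f'"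
      using t(2) unfolding X_def by blast
  qed
qed

text \<open>Constants are adjoined one at a time, starting from the integers. The induction keeps a
  subring \<open>K\<close> that contains those treated so far and all of whose finite subsets are
  eliminable; a new \<open>c\<close> is transcendental or algebraic over \<open>K\<close>, and
  \<open>K\<close> is enlarged to \<open>K[c]\<close>.\<close>

theorem eliminable_finite:
  assumes "finite A"
  shows "eliminable (with_consts A)"
proof -
  have "\<exists>K. is_subring K \<and> A \<subseteq> K \<and> (\<forall>B. finite B \<longrightarrow> B \<subseteq> K \<longrightarrow> eliminable (with_consts B))"
    using assms
  proof (induction A rule: finite_induct)
    case empty
    have "is_subring (range (of_int :: int \<Rightarrow> complex))"
      by (rule subring_range) (auto simp: is_hom_def is_subring_def)
    then show ?case using eliminable_int by blast
  next
    case (insert c A)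
    then obtain K where K: "is_subring K" "A \<subseteq> K"
      "\<And>B. finite B \<Longrightarrow> B \<subseteq> K \<Longrightarrow> eliminable (with_consts B)" by blast
    have "eliminable (with_consts (insert c B))" if "finite B" "B \<subseteq> K" for B
      using eliminable_transcendental[OF K(1) that(2) K(3)[OF that], of c]
        eliminable_algebraic[OF K(1) that K(3), of _ c] by blast
    then have "\<forall>B. finite B \<longrightarrow> B \<subseteq> adjoin K c \<longrightarrow> eliminable (with_consts B)"
      using eliminable_adjoin[OF K(1)] by blast
    then show ?case using subring_adjoin[OF K(1)] insert_subset_adjoin[OF K(1), of c] K(2)
      by (intro exI[of _ "adjoin K c"]) blast
  qed
  then show ?thesis using assms by blast
qed

section \<open>From the digit conjecture to the \<open>\<tau>\<close>-conjecture\<close>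

lemma is_hom_pcompose: "is_hom (\<lambda>F. pcompose F q)"
  by (simp add: is_hom_def pcompose_add pcompose_diff pcompose_mult)

text \<open>Composition with \<open>q\<close> is a homomorphism, so the program for \<open>f\<close>
  runs with \<open>q\<close> in place of the indeterminate once \<open>q\<close> has been
  computed.\<close>

lemma tau_pcompose_le:
  assumes "computes {1, [:0, 1:]} n {q}"
  shows "tau (pcompose f q) \<le> tau f + n + 1"
proof -
  obtain Y where Y: "slp {1, [:0, 1:]} (tau f) Y" "f \<in> Y"
    using computes_tau[of f] by (auto simp: computes_def)
  have "slp {1, q} (tau f) ((\<lambda>F. pcompose F q) ` Y)"
    using slp_hom[OF Y(1) is_hom_pcompose, of q] by (simp add: pcompose_1 pcompose_pCons)
  then have "computes {1, q} (tau f) {pcompose f q}" using Y(2) by (auto simp: computes_def)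
  then have "computes ({1, [:0, 1:]} \<union> {q}) (tau f) {pcompose f q}" by (rule computes_mono) auto
  from computes_trans[OF assms this] have "computes {1, [:0, 1:]} (tau f + n) {pcompose f q}"
    by (rule computes_mono) auto
  then show ?thesis using tau_le by fastforce
qed

text \<open>Without operations only 1 and the indeterminate arise. The case is separate because
  \<open>(tau f + 1) powr \<kappa>\<close> is then 1 for every exponent and leaves no room for a
  constant factor.\<close>

lemma card_roots_tau_0:
  assumes "tau f = 0" "f \<noteq> 0"
  shows "card {x. poly f x = 0} \<le> 1"
proof -
  obtain Y where "slp {1, [:0, 1:]} 0 Y" "f \<in> Y"
    using computes_tau[of f] assms(1) by (auto simp: computes_def)
  moreover from this(1) have "Y = {1, [:0, 1:]}" by cases auto
  ultimately have "{x. poly f x = 0} \<subseteq> {0}" by auto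
  then show ?thesis using card_mono[of "{0::int}"] by fastforce
qed

text \<open>Each residue class modulo \<open>p\<close> is moved to the class of 1 by a substitution
  \<open>x \<mapsto> x + (r - 1)\<close>, which costs boundedly many operations.\<close>

theorem digit_conjecture_imp_tau_conjecture:
  assumes "p > 0" "digit_conjecture p"
  shows tau_conjecture
proof -
  obtain c where c: "c > 0" and digit: "\<And>f::int poly. f \<noteq> 0 \<Longrightarrow>
      real (card {x::int. poly f x = 0 \<and> [x = 1] (mod int p)}) \<le> (real (tau f) + 1) powr c"
    using assms(2) unfolding digit_conjecture_def by blast
  define q where "q r = [:int r - 1, 1:]" for r
  have "\<exists>n. computes {1, [:0, 1:]} n {q r}" for r by (rule int_poly_computable)
  then obtain N where N: "computes {1, [:0, 1:]} N (q ` {..<p})"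
    using computes_bounded[of "q ` {..<p}" "{1, [:0, 1:]}"] by blast
  have card: "real (card {x. poly f x = 0}) \<le> real p * (real (tau f) + N + 2) powr c"
    if f: "f \<noteq> 0" for f :: "int poly"
  proof -
    define Z where "Z r = {y::int. poly (pcompose f (q r)) y = 0 \<and> [y = 1] (mod int p)}" for r
    have nz: "pcompose f (q r) \<noteq> 0" for r
      using f pcompose_eq_0[of f "q r"] by (auto simp: q_def)
    have finZ: "finite (Z r)" for r
      unfolding Z_def by (rule finite_subset[OF _ poly_roots_finite[OF nz[of r]]]) auto
    have "{x. poly f x = 0} \<subseteq> (\<Union>r<p. (\<lambda>y. y + (int r - 1)) ` Z r)"
    proof
      fix x assume x: "x \<in> {x. poly f x = 0}"
      define r where "r = nat (x mod int p)"
      have r: "int r = x mod int p" "r < p" using assms(1) by (simp_all add: r_def nat_less_iff)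
      have "[x - (int r - 1) = 1] (mod int p)"
        by (simp add: cong_iff_dvd_diff r(1) minus_mod_eq_mult_div)
      then have "x - (int r - 1) \<in> Z r" using x by (simp add: Z_def poly_pcompose q_def)
      then show "x \<in> (\<Union>r<p. (\<lambda>y. y + (int r - 1)) ` Z r)" using r(2) by force
    qed
    then have "card {x. poly f x = 0} \<le> card (\<Union>r<p. (\<lambda>y. y + (int r - 1)) ` Z r)"
      using finZ by (intro card_mono) auto
    also have "\<dots> \<le> (\<Sum>r<p. card ((\<lambda>y. y + (int r - 1)) ` Z r))" by (intro card_UN_le) auto
    also have "\<dots> \<le> (\<Sum>r<p. card (Z r))" using finZ by (intro sum_mono card_image_le)
    finally have "real (card {x. poly f x = 0}) \<le> (\<Sum>r<p. real (card (Z r)))"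
      by (simp flip: of_nat_sum)
    also have "\<dots> \<le> (\<Sum>r<p. (real (tau f) + N + 2) powr c)"
    proof (intro sum_mono)
      fix r assume "r \<in> {..<p}"
      then have "computes {1, [:0, 1:]} N {q r}" by (intro computes_mono[OF N]) auto
      from tau_pcompose_le[OF this, of f] have "real (tau (pcompose f (q r))) + 1 \<le> real (tau f) + N + 2"
        by linarith
      then have "(real (tau (pcompose f (q r))) + 1) powr c \<le> (real (tau f) + N + 2) powr c"
        using c by (intro powr_mono2) auto
      then show "real (card (Z r)) \<le> (real (tau f) + N + 2) powr c"
        using digit[OF nz, of r] unfolding Z_def by linarith
    qed
    finally show ?thesis by simp
  qed
  define D where "D = real p * (real N + 2) powr c"
  have "1 \<le> (real N + 2) powr c" using c by (intro ge_one_powr_ge_zero) auto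
  then have D: "D \<ge> 1" unfolding D_def using assms(1) mult_mono[of 1 "real p" 1 "(real N + 2) powr c"] by simp
  \<comment> \<open>For \<open>T \<ge> 2\<close> the constant factor \<open>D\<close> is absorbed
    into the exponent, as \<open>D = 2 powr log 2 D \<le> T powr log 2 D\<close>.\<close>
  define \<kappa> where "\<kappa> = max 1 (log 2 D + c)"
  have "real (card {x. poly f x = 0}) \<le> (real (tau f) + 1) powr \<kappa>" if f: "f \<noteq> 0" for f :: "int poly"
  proof (cases "tau f = 0")
    case True
    then show ?thesis using card_roots_tau_0[OF True f] by simp
  next
    case False
    define T where "T = real (tau f) + 1"
    have T: "T \<ge> 2" using False by (simp add: T_def)
    have "real (tau f) + N + 2 \<le> (real N + 2) * T"
      using mult_left_mono[of 1 "real (tau f)" "real N + 1"] False by (simp add: T_def algebra_simps)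
    then have "(real (tau f) + N + 2) powr c \<le> ((real N + 2) * T) powr c"
      using c by (intro powr_mono2) auto
    then have "real p * (real (tau f) + N + 2) powr c \<le> D * T powr c"
      using T by (simp add: D_def powr_mult mult_left_mono mult.assoc)
    also have "\<dots> = 2 powr (log 2 D) * T powr c" using D by simp
    also have "\<dots> \<le> T powr (log 2 D) * T powr c"
      using T D by (intro mult_right_mono powr_mono2) auto
    also have "\<dots> = T powr (log 2 D + c)" by (simp add: powr_add)
    also have "\<dots> \<le> T powr \<kappa>" using T by (intro powr_mono) (auto simp: \<kappa>_def)
    finally show ?thesis using card[OF f] by (simp add: T_def)
  qed
  then show ?thesis unfolding tau_conjecture_def by (intro exI[of _ \<kappa>]) (auto simp: \<kappa>_def)
qed

section \<open>Symbolic execution of machines\<close>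

text \<open>Symbolic execution on an input whose coordinates are all the indeterminate: a cell holds the
  numerator and the denominator of a rational function.\<close>

fun sym_exec :: "complex instr \<Rightarrow> (complex poly \<times> complex poly) config \<Rightarrow> (complex poly \<times> complex poly) config" where
  "sym_exec (Const i c) (pc, s) = (Suc pc, s(i := ([:c:], 1)))"
| "sym_exec (Add i j k) (pc, s) =
    (Suc pc, s(i := (fst (s j) * snd (s k) + fst (s k) * snd (s j), snd (s j) * snd (s k))))"
| "sym_exec (Sub i j k) (pc, s) =
    (Suc pc, s(i := (fst (s j) * snd (s k) - fst (s k) * snd (s j), snd (s j) * snd (s k))))"
| "sym_exec (Mul i j k) (pc, s) = (Suc pc, s(i := (fst (s j) * fst (s k), snd (s j) * snd (s k))))"
| "sym_exec (Div i j k) (pc, s) =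
    (if fst (s k) = 0 then (pc, s)
     else (Suc pc, s(i := (fst (s j) * snd (s k), snd (s j) * fst (s k)))))"
| "sym_exec (IfZero i l l') (pc, s) = ((if fst (s i) = 0 then l else l'), s)"
| "sym_exec ShiftL (pc, s) = (Suc pc, \<lambda>i. s (i + 1))"
| "sym_exec ShiftR (pc, s) = (Suc pc, \<lambda>i. s (i - 1))"

definition sym_step :: "complex machine \<Rightarrow> (complex poly \<times> complex poly) config \<Rightarrow> (complex poly \<times> complex poly) config" where
  "sym_step M cfg = (if length M \<le> fst cfg then cfg else sym_exec (M ! fst cfg) cfg)"

text \<open>Blank cells hold 0 with denominator 1, so that every denominator is nonzero from the
  start.\<close>

definition sym_tape :: "nat \<Rightarrow> int \<Rightarrow> complex poly \<times> complex poly" where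
  "sym_tape n i =
     (if 1 \<le> i \<and> i \<le> int n then ([:0, 1:], 1) else if - int n < i \<and> i \<le> 0 then (1, 1) else (0, 1))"

definition eval_config :: "complex \<Rightarrow> (complex poly \<times> complex poly) config \<Rightarrow> complex config" where
  "eval_config z cfg = (fst cfg, \<lambda>i. poly (fst (snd cfg i)) z / poly (snd (snd cfg i)) z)"

text \<open>A single pool \<open>W\<close> serves the whole infinite tape; after finitely many steps
  it can be taken finite.\<close>

definition cells_in :: "complex poly set \<Rightarrow> (complex poly \<times> complex poly) config \<Rightarrow> bool" where
  "cells_in W cfg \<longleftrightarrow> (\<forall>i. fst (snd cfg i) \<in> W \<and> snd (snd cfg i) \<in> W - {0})"

text \<open>Instructions without a constant get 0, which is among the inputs anyway as the content
  of blank cells.\<close>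

fun instr_const :: "complex instr \<Rightarrow> complex" where
  "instr_const (Const i c) = c"
| "instr_const _ = 0"

lemma cells_in_mono: "cells_in W cfg \<Longrightarrow> W \<subseteq> W' \<Longrightarrow> cells_in W' cfg"
  unfolding cells_in_def by blast

lemma cells_in_update:
  assumes "cells_in W (pc, s)" "computes W 4 {a, b}" "b \<noteq> 0"
  shows "\<exists>W'. slp W 4 W' \<and> cells_in W' (pc', s(i := (a, b)))"
proof -
  obtain W' where W': "slp W 4 W'" "a \<in> W'" "b \<in> W'" using assms(2) by (auto simp: computes_def)
  have "cells_in W' (pc', s(i := (a, b)))"
    using assms(1,3) W' slp_subset[OF W'(1)] unfolding cells_in_def by auto
  then show ?thesis using W'(1) by blast
qed

text \<open>Addition and subtraction of fractions are the most expensive, with three products and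
  one sum or difference.\<close>

lemma sym_exec_cells_in:
  assumes s: "cells_in W (pc, s)" and ins: "[:instr_const ins:] \<in> W" "1 \<in> W"
  shows "\<exists>W'. slp W 4 W' \<and> cells_in W' (sym_exec ins (pc, s))"
proof -
  have c: "computes W 0 {fst (s j)}" "computes W 0 {snd (s j)}" "snd (s j) \<noteq> 0" for j
    using s by (auto simp: cells_in_def intro: computes_refl)
  have same: "\<exists>W'. slp W 4 W' \<and> cells_in W' cfg" if "cells_in W cfg" for cfg
    using that slp.refl by blast
  show ?thesis
  proof (cases ins)
    case (Const i a)
    then show ?thesis using ins by (auto intro!: cells_in_update[OF s] computes_refl)
  next
    case (Add i j k)
    have "computes W (0 + 0 + 1 + (0 + 0 + 1) + 1 + (0 + 0 + 1))
      ({fst (s j) * snd (s k) + fst (s k) * snd (s j)} \<union> {snd (s j) * snd (s k)})"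
      by (intro computes_Un computes_add computes_mult c)
    then show ?thesis using Add c by (auto intro!: cells_in_update[OF s] elim: computes_mono)
  next
    case (Sub i j k)
    have "computes W (0 + 0 + 1 + (0 + 0 + 1) + 1 + (0 + 0 + 1))
      ({fst (s j) * snd (s k) - fst (s k) * snd (s j)} \<union> {snd (s j) * snd (s k)})"
      by (intro computes_Un computes_diff computes_mult c)
    then show ?thesis using Sub c by (auto intro!: cells_in_update[OF s] elim: computes_mono)
  next
    case (Mul i j k)
    have "computes W (0 + 0 + 1 + (0 + 0 + 1)) ({fst (s j) * fst (s k)} \<union> {snd (s j) * snd (s k)})"
      by (intro computes_Un computes_mult c)
    then show ?thesis using Mul c by (auto intro!: cells_in_update[OF s] elim: computes_mono)
  next
    case (Div i j k)
    have "computes W (0 + 0 + 1 + (0 + 0 + 1)) ({fst (s j) * snd (s k)} \<union> {snd (s j) * fst (s k)})"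
      by (intro computes_Un computes_mult c)
    then have "fst (s k) \<noteq> 0 \<Longrightarrow> ?thesis"
      using Div c by (auto intro!: cells_in_update[OF s] elim: computes_mono)
    then show ?thesis using Div s same by auto
  next
    case (IfZero i l l')
    then show ?thesis using s by (intro same) (auto simp: cells_in_def)
  next
    case ShiftL
    then show ?thesis using s by (intro same) (auto simp: cells_in_def)
  next
    case ShiftR
    then show ?thesis using s by (intro same) (auto simp: cells_in_def)
  qed
qed

lemma sym_run_cells_in:
  assumes X: "X = with_consts (insert 0 (instr_const ` set M))"
  shows "\<exists>W. slp X (4 * T) W \<and> (\<forall>t\<le>T. cells_in W ((sym_step M ^^ t) (0, sym_tape n)))"
proof (induction T)
  case 0
  have "cells_in X (0, sym_tape n)" by (auto simp: cells_in_def sym_tape_def X with_consts_def)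
  then show ?case using slp.refl by auto
next
  case (Suc T)
  then obtain W where W: "slp X (4 * T) W" "\<forall>t\<le>T. cells_in W ((sym_step M ^^ t) (0, sym_tape n))"
    by blast
  define cfg where "cfg = (sym_step M ^^ T) (0, sym_tape n)"
  have cfg: "cells_in W (fst cfg, snd cfg)" using W(2) by (simp add: cfg_def)
  have "\<exists>W'. slp W 4 W' \<and> cells_in W' (sym_step M cfg)"
  proof (cases "length M \<le> fst cfg")
    case True
    then show ?thesis using cfg slp.refl by (auto simp: sym_step_def)
  next
    case False
    then have "M ! fst cfg \<in> set M" by simp
    then have "[:instr_const (M ! fst cfg):] \<in> W" "1 \<in> W"
      using slp_subset[OF W(1)] by (auto simp: X with_consts_def)
    from sym_exec_cells_in[OF cfg this] show ?thesis using False by (simp add: sym_step_def)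
  qed
  then obtain W' where W': "slp W 4 W'" "cells_in W' (sym_step M cfg)" by blast
  have "slp X (4 * Suc T) W'" using slp_trans[OF W'(1) W(1)] by (simp add: add_ac)
  moreover have "cells_in W' ((sym_step M ^^ t) (0, sym_tape n))" if "t \<le> Suc T" for t
  proof (cases "t = Suc T")
    case True
    then show ?thesis using W'(2) by (simp add: cfg_def)
  next
    case False
    then have "t \<le> T" using that by simp
    then show ?thesis using W(2) cells_in_mono slp_subset[OF W'(1)] by blast
  qed
  ultimately show ?case by blast
qed

text \<open>Away from the zeros of the nonzero polynomials in \<open>W\<close>, a zero test has the
  same outcome on a value as on its numerator polynomial, and no denominator vanishes.\<close>

lemma eval_sym_step:
  assumes W: "cells_in W cfg" and z: "\<And>g. g \<in> W \<Longrightarrow> g \<noteq> 0 \<Longrightarrow> poly g z \<noteq> 0"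
  shows "step M (eval_config z cfg) = eval_config z (sym_step M cfg)"
proof -
  obtain pc s where cfg: "cfg = (pc, s)" by (cases cfg)
  have D: "poly (snd (s i)) z \<noteq> 0" and N: "poly (fst (s i)) z = 0 \<longleftrightarrow> fst (s i) = 0" for i
    using W z by (auto simp: cells_in_def cfg)
  have "exec ins (eval_config z cfg) = eval_config z (sym_exec ins cfg)" for ins
    by (cases ins) (auto simp: eval_config_def cfg D N field_simps fun_eq_iff)
  then show ?thesis by (simp add: step_def halted_def sym_step_def) (simp add: eval_config_def)
qed

lemma eval_sym_run:
  assumes "\<forall>t\<le>T. cells_in W ((sym_step M ^^ t) (0, sym_tape n))"
    and "\<And>g. g \<in> W \<Longrightarrow> g \<noteq> 0 \<Longrightarrow> poly g z \<noteq> 0" and "t \<le> T"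
  shows "run M (replicate n z) t = eval_config z ((sym_step M ^^ t) (0, sym_tape n))"
  using assms(3)
proof (induction t)
  case 0
  then show ?case by (auto simp: run_def eval_config_def sym_tape_def input_tape_def fun_eq_iff)
next
  case (Suc t)
  then have "run M (replicate n z) (Suc t) = step M (eval_config z ((sym_step M ^^ t) (0, sym_tape n)))"
    by (simp add: run_def)
  also have "\<dots> = eval_config z ((sym_step M ^^ Suc t) (0, sym_tape n))"
    using eval_sym_step[of W _ z M, OF _ assms(2)] assms(1) Suc.prems by simp
  finally show ?case .
qed

text \<open>A halted configuration is fixed, so the answer can be read at the time bound
  itself.\<close>

lemma run_halted:
  assumes "halted M (run M x t)" "t \<le> T"
  shows "run M x T = run M x t"
  using assms(2)
proof (induction T rule: dec_induct)
  case (step T)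
  then show ?case using assms(1) by (simp add: run_def step_def)
qed simp

text \<open>A generic point follows the same path as the symbolic computation and is rejected, so every
  accepted point is a zero of some nonzero polynomial that occurs on this path.\<close>

lemma decides_in_time_poly:
  assumes M: "decides_in_time M S T" and n: "n \<ge> 1" and inf: "infinite {z. replicate n z \<notin> S}"
    and X: "X = with_consts (insert 0 (instr_const ` set M))"
  shows "\<exists>F. F \<noteq> 0 \<and> computes X (8 * T n + card X) {F} \<and> (\<forall>z. replicate n z \<in> S \<longrightarrow> poly F z = 0)"
proof -
  obtain W where W: "slp X (4 * T n) W" "\<forall>t\<le>T n. cells_in W ((sym_step M ^^ t) (0, sym_tape n))"
    using sym_run_cells_in[OF X] by blast
  have "finite X" by (simp add: X with_consts_def)
  then have fin: "finite W" "card W \<le> card X + 4 * T n" using slp_finite[OF W(1)] by auto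
  \<comment> \<open>Where this product does not vanish, no nonzero polynomial of the path vanishes:
    such points are generic.\<close>
  define F where "F = \<Prod>(W - {0})"
  have F: "F \<noteq> 0" using fin(1) by (simp add: F_def)
  have "1 \<in> W" using slp_subset[OF W(1)] by (auto simp: X with_consts_def)
  then have "computes W (card (W - {0})) {F}"
    unfolding F_def using fin(1) by (intro computes_prod) auto
  \<comment> \<open>The product takes at most one multiplication for each element of
    \<open>W\<close>.\<close>
  then have "computes W (4 * T n + card X) {F}"
    using fin card_mono[OF fin(1), of "W - {0}"] by (elim computes_mono) auto
  then obtain W' where W': "slp W (4 * T n + card X) W'" "F \<in> W'" by (auto simp: computes_def)
  have comp: "computes X (8 * T n + card X) {F}"
    using slp_trans[OF W'(1) W(1)] W'(2) by (auto simp: computes_def)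
  define R where "R = snd ((sym_step M ^^ T n) (0, sym_tape n)) 1"
  have out: "poly (fst R) z / poly (snd R) z = (if replicate n z \<in> S then 1 else 0)" if "poly F z \<noteq> 0" for z
  proof -
    have "poly g z \<noteq> 0" if "g \<in> W" "g \<noteq> 0" for g
      using \<open>poly F z \<noteq> 0\<close> that fin(1) by (auto simp: F_def poly_prod)
    from eval_sym_run[OF W(2) this, of "T n"]
    have eq: "run M (replicate n z) (T n) = eval_config z ((sym_step M ^^ T n) (0, sym_tape n))" by simp
    have "replicate n z \<in> C_inf" using n by (simp add: C_inf_def)
    then obtain t where t: "t \<le> T n" "halted M (run M (replicate n z) t)"
      "snd (run M (replicate n z) t) 1 = (if replicate n z \<in> S then 1 else 0)"
      using M unfolding decides_in_time_def by fastforce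
    have "snd (run M (replicate n z) (T n)) 1 = (if replicate n z \<in> S then 1 else 0)"
      using run_halted[OF t(2,1)] t(3) by simp
    then show ?thesis by (simp add: eq eval_config_def R_def)
  qed
  \<comment> \<open>Only finitely many points are not generic, so some rejected point is.\<close>
  have "infinite ({z. replicate n z \<notin> S} - {z. poly F z = 0})"
    using inf poly_roots_finite[OF F] by (rule Diff_infinite_finite[rotated])
  then have "{z. replicate n z \<notin> S} - {z. poly F z = 0} \<noteq> {}" by (rule infinite_imp_nonempty)
  then obtain z0 where z0: "replicate n z0 \<notin> S" "poly F z0 \<noteq> 0" by blast
  have R: "fst R \<in> W" "snd R \<in> W - {0}" using W(2) by (auto simp: cells_in_def R_def)
  have nz: "poly g z0 \<noteq> 0" if "g \<in> W - {0}" for g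
    using z0(2) that fin(1) by (auto simp: F_def poly_prod)
  have "poly (fst R) z0 = 0" using out[OF z0(2)] z0(1) nz[OF R(2)] by simp
  \<comment> \<open>The output numerator lies in the pool and vanishes at a generic point, hence it
    is the zero polynomial; a point where \<open>F\<close> is nonzero can then not be
    accepted.\<close>
  then have "fst R = 0" using nz[of "fst R"] R(1) by blast
  then have "poly F z = 0" if "replicate n z \<in> S" for z
    using out[of z] that by auto
  then show ?thesis using F comp by blast
qed

section \<open>A problem in NP with exponentially many integer instances\<close>

text \<open>The default 0 agrees with the blank cell that a machine reads after the end of its
  input.\<close>

definition hd0 :: "'a::zero list \<Rightarrow> 'a" where
  "hd0 xs = (case xs of [] \<Rightarrow> 0 | x # _ \<Rightarrow> x)"

text \<open>A digit chain records the successive quotients of a binary expansion up to the first zero;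
  repetitions are allowed, so that the input \<open>(z, \<dots>, z)\<close> can be the beginning of a chain.\<close>

fun digit_chain :: "complex list \<Rightarrow> bool" where
  "digit_chain [] = True"
| "digit_chain (a # r) \<longleftrightarrow>
    a = 0 \<or> (a = hd0 r \<or> a = 2 * hd0 r \<or> a = 2 * hd0 r + 1) \<and> digit_chain r"

text \<open>Backwards from the end, each entry is an integer expression in the next one, and the
  chain ends in a zero or in the default 0.\<close>

lemma digit_chain_Ints: "digit_chain r \<Longrightarrow> hd0 r \<in> \<int>"
  by (induction r) (auto simp: hd0_def[of "_ # _"], auto simp: hd0_def)

fun halves :: "nat \<Rightarrow> nat \<Rightarrow> complex list" where
  "halves k 0 = []"
| "halves k (Suc m) = of_nat (k div 2) # halves (k div 2) m"

lemma length_halves: "length (halves k m) = m"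
  by (induction m arbitrary: k) auto

text \<open>A number below \<open>2 ^ m\<close> reaches 0 after \<open>m\<close> halvings.\<close>

lemma digit_chain_halves: "k < 2 ^ m \<Longrightarrow> digit_chain (of_nat k # halves k m)"
proof (induction m arbitrary: k)
  case (Suc m)
  have "k = 2 * (k div 2) \<or> k = 2 * (k div 2) + 1" by presburger
  then have "(of_nat k :: complex) = 2 * of_nat (k div 2) \<or> (of_nat k :: complex) = 2 * of_nat (k div 2) + 1"
    by (metis of_nat_1 of_nat_add of_nat_mult of_nat_numeral)
  moreover have "digit_chain (of_nat (k div 2) # halves (k div 2) m)" using Suc by simp
  ultimately show ?case by (simp add: hd0_def del: digit_chain.simps(2)) (simp add: hd0_def)
qed simp

lemma digit_chain_replicate: "digit_chain (z # y) \<Longrightarrow> digit_chain (replicate n z @ z # y)"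
proof (induction n)
  case (Suc n)
  have "hd0 (replicate n z @ z # y) = z" by (cases n) (simp_all add: hd0_def)
  then show ?case using Suc by simp
qed simp

text \<open>Cells 0 and -1 are scratch space. Instructions 1 to 7 compare cell 1 with cell 2 by
  subtracting cell 2 once, then again, then 1; success leads to a shift and a restart (8 and 9).
  Instruction 0 accepts at a zero, 10 and 12 write the answer, and 13 is the first position outside
  the program.\<close>

definition verifier :: "complex machine" where
  "verifier =
    [IfZero 1 10 1, Sub 0 1 2, IfZero 0 8 3, Sub 0 0 2, IfZero 0 8 5, Const (-1) 1, Sub 0 0 (-1),
     IfZero 0 8 12, ShiftL, IfZero 0 0 0, Const 1 1, IfZero 1 13 13, Const 1 0]"

lemma verifier_step:
  "step verifier (0, s) = (if s 1 = 0 then 10 else Suc 0, s)"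
  "step verifier (Suc 0, s) = (2, s(0 := s 1 - s 2))"
  "step verifier (2, s) = (if s 0 = 0 then 8 else 3, s)"
  "step verifier (3, s) = (4, s(0 := s 0 - s 2))"
  "step verifier (4, s) = (if s 0 = 0 then 8 else 5, s)"
  "step verifier (5, s) = (6, s(-1 := 1))"
  "step verifier (6, s) = (7, s(0 := s 0 - s (-1)))"
  "step verifier (7, s) = (if s 0 = 0 then 8 else 12, s)"
  "step verifier (8, s) = (9, \<lambda>i. s (i + 1))"
  "step verifier (9, s) = (0, s)"
  "step verifier (10, s) = (11, s(1 := 1))"
  "step verifier (11, s) = (13, s)"
  "step verifier (12, s) = (13, s(1 := 0))"
  by (simp_all add: step_def halted_def verifier_def)

lemma funpow_step: "(step M ^^ Suc n) cfg = (step M ^^ n) (step M cfg)"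
  by (simp add: funpow_swap1)

text \<open>The hypothesis concerns positive cells only and so survives the scratch writes and the
  shift. Each entry takes at most 10 steps, and acceptance 3.\<close>

lemma verifier_correct:
  assumes "\<And>i. i \<ge> 1 \<Longrightarrow> s i = (if i \<le> int (length r) then r ! nat (i - 1) else 0)"
  shows "\<exists>t \<le> 10 * length r + 3. \<exists>s'. (step verifier ^^ t) (0, s) = (13, s') \<and>
    s' 1 = (if digit_chain r then 1 else 0)"
  using assms
proof (induction r arbitrary: s)
  case Nil
  then have "s 1 = 0" by simp
  then have "(step verifier ^^ Suc (Suc (Suc 0))) (0, s) = (13, s(1 := 1))"
    by (simp add: funpow_step verifier_step del: funpow.simps(2))
  then show ?case by (intro exI[of _ "Suc (Suc (Suc 0))"]) auto
next
  case (Cons a r)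
  have s: "s 1 = a" "s 2 = hd0 r"
    using Cons.prems[of 1] Cons.prems[of 2] by (auto simp: hd0_def split: list.splits)
  have tail: "\<exists>t \<le> 10 * length r + 3. \<exists>s''. (step verifier ^^ t) (0, s') = (13, s'') \<and>
      s'' 1 = (if digit_chain r then 1 else 0)" if "\<And>i. i \<ge> 1 \<Longrightarrow> s' i = s (i + 1)" for s'
  proof (rule Cons.IH)
    fix i :: int assume i: "i \<ge> 1"
    then show "s' i = (if i \<le> int (length r) then r ! nat (i - 1) else 0)"
      using that[OF i] Cons.prems[of "i + 1"] by (auto simp: nth_Cons' nat_diff_distrib)
  qed
  \<comment> \<open>A pass that ends with the shift reduces the claim to the tail
    \<open>r\<close>.\<close>
  have loop: ?case if k: "(step verifier ^^ k) (0, s) = (0, s')" "k \<le> 10"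
    and s': "\<And>i. i \<ge> 1 \<Longrightarrow> s' i = s (i + 1)" and "digit_chain (a # r) \<longleftrightarrow> digit_chain r" for k s'
  proof -
    obtain t s'' where t: "t \<le> 10 * length r + 3" "(step verifier ^^ t) (0, s') = (13, s'')"
      "s'' 1 = (if digit_chain r then 1 else 0)" using tail[OF s'] by blast
    then have "(step verifier ^^ (t + k)) (0, s) = (13, s'')" using k(1) by (simp add: funpow_add)
    then show ?thesis using t(1,3) k(2) that(4) by (intro exI[of _ "t + k"]) simp
  qed
  consider "a = 0" | "a \<noteq> 0" "a = hd0 r" | "a \<noteq> 0" "a \<noteq> hd0 r" "a = 2 * hd0 r"
    | "a \<noteq> 0" "a \<noteq> hd0 r" "a \<noteq> 2 * hd0 r" "a = 2 * hd0 r + 1"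
    | "a \<noteq> 0" "a \<noteq> hd0 r" "a \<noteq> 2 * hd0 r" "a \<noteq> 2 * hd0 r + 1" by blast
  then show ?case
  proof cases
    case 1
    then have "(step verifier ^^ (Suc (Suc (Suc 0)))) (0, s) = (13, s(1 := 1))"
      by (simp add: funpow_step verifier_step s del: funpow.simps(2))
    then show ?thesis using 1 by (intro exI[of _ "(Suc (Suc (Suc 0)))"]) auto
  next
    case 2
    then have "(step verifier ^^ (Suc (Suc (Suc (Suc (Suc 0)))))) (0, s) = (0, \<lambda>i. (s(0 := a - hd0 r)) (i + 1))"
      by (simp add: funpow_step verifier_step s del: funpow.simps(2))
    then show ?thesis by (rule loop) (use 2 in auto)
  next
    case 3
    then have "(step verifier ^^ (Suc (Suc (Suc (Suc (Suc (Suc (Suc 0)))))))) (0, s) = (0, \<lambda>i. (s(0 := a - hd0 r - hd0 r)) (i + 1))"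
      by (simp add: funpow_step verifier_step s del: funpow.simps(2))
    then show ?thesis by (rule loop) (use 3 in auto)
  next
    case 4
    then have "(step verifier ^^ (Suc (Suc (Suc (Suc (Suc (Suc (Suc (Suc (Suc (Suc 0))))))))))) (0, s) =
        (0, \<lambda>i. (s(0 := a - hd0 r - hd0 r - 1, -1 := 1)) (i + 1))"
      by (simp add: funpow_step verifier_step s fun_upd_twist del: funpow.simps(2))
    then show ?thesis by (rule loop) (use 4 in auto)
  next
    case 5
    then have "(step verifier ^^ (Suc (Suc (Suc (Suc (Suc (Suc (Suc (Suc (Suc 0)))))))))) (0, s) =
        (13, s(0 := a - hd0 r - hd0 r - 1, -1 := 1, 1 := 0))"
      by (simp add: funpow_step verifier_step s fun_upd_twist algebra_simps del: funpow.simps(2))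
    then show ?thesis using 5 by (intro exI[of _ "(Suc (Suc (Suc (Suc (Suc (Suc (Suc (Suc (Suc 0)))))))))"]) auto
  qed
qed

lemma verifier_decides:
  "decides_in_time verifier {w \<in> C_inf. digit_chain w} (poly [:3, 10:])"
  unfolding decides_in_time_def
proof
  fix x assume x: "x \<in> C_inf"
  have "\<exists>t \<le> 10 * length x + 3. \<exists>s'. (step verifier ^^ t) (0, input_tape x) = (13, s') \<and>
    s' 1 = (if digit_chain x then 1 else 0)"
    by (rule verifier_correct) (auto simp: input_tape_def)
  then obtain t s' where t: "t \<le> 10 * length x + 3" "run verifier x t = (13, s')"
    "s' 1 = (if digit_chain x then 1 else 0)" unfolding run_def by blast
  have "halted verifier (run verifier x t)" unfolding t(2) by (simp add: halted_def verifier_def)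
  moreover have "snd (run verifier x t) 1 = (if x \<in> {w \<in> C_inf. digit_chain w} then 1 else 0)"
    using x t(2,3) by simp
  ultimately show "\<exists>t\<le>poly [:3, 10:] (length x). halted verifier (run verifier x t) \<and>
      snd (run verifier x t) 1 = (if x \<in> {w \<in> C_inf. digit_chain w} then 1 else 0)"
    using t(1) by (intro exI[of _ t]) (simp add: mult.commute)
qed

text \<open>A guess as long as the input leaves room for \<open>n\<close> halvings, enough for every
  natural number below \<open>2 ^ n\<close>.\<close>

definition chain_prefixes :: "complex list set" where
  "chain_prefixes = {x \<in> C_inf. \<exists>y. length y = length x \<and> digit_chain (x @ y)}"

lemma chain_prefixes_NP: "chain_prefixes \<in> NP_C"
proof -
  have "{w \<in> C_inf. digit_chain w} \<in> P_C" using verifier_decides by (auto simp: P_C_def)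
  moreover have "x \<in> chain_prefixes \<longleftrightarrow>
      (\<exists>y. length y = poly [:0, 1:] (length x) \<and> x @ y \<in> {w \<in> C_inf. digit_chain w})"
    if "x \<in> C_inf" for x
    using that by (auto simp: chain_prefixes_def C_inf_def)
  ultimately show ?thesis unfolding NP_C_def
    by (intro CollectI conjI exI[of _ "[:0, 1:]"] bexI[of _ "{w \<in> C_inf. digit_chain w}"])
      (auto simp: chain_prefixes_def)
qed

lemma replicate_of_nat_in_chain_prefixes:
  assumes "n \<ge> 1" "k < 2 ^ n"
  shows "replicate n (of_nat k) \<in> chain_prefixes"
proof -
  obtain m where m: "n = Suc m" using assms(1) by (cases n) auto
  \<comment> \<open>One of the \<open>n\<close> copies of \<open>k\<close> is the head of the
    halving chain; the other \<open>m\<close> repeat it.\<close>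
  have "digit_chain (replicate m (of_nat k) @ of_nat k # halves k n)"
    by (intro digit_chain_replicate digit_chain_halves assms)
  then have "digit_chain (replicate n (of_nat k) @ halves k n)"
    by (simp add: m replicate_app_Cons_same del: halves.simps)
  then show ?thesis using assms(1) length_halves[of k n] by (auto simp: chain_prefixes_def C_inf_def)
qed

lemma replicate_in_chain_prefixes_Ints:
  assumes "replicate n z \<in> chain_prefixes"
  shows "z \<in> \<int>"
proof -
  obtain y where "n \<ge> 1" "digit_chain (replicate n z @ y)"
    using assms by (auto simp: chain_prefixes_def C_inf_def)
  from digit_chain_Ints[OF this(2)] this(1) show ?thesis by (cases n) (auto simp: hd0_def)
qed

section \<open>The separation\<close>

lemma nat_poly_le: "\<exists>a d. \<forall>n\<ge>1. poly (q :: nat poly) n \<le> a * n ^ d"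
proof (induction q)
  case 0
  show ?case by (intro exI[of _ 0]) simp
next
  case (pCons c q)
  then obtain a d where ad: "\<And>n. n \<ge> 1 \<Longrightarrow> poly q n \<le> a * n ^ d" by blast
  have "poly (pCons c q) n \<le> (c + a) * n ^ Suc d" if n: "n \<ge> 1" for n
  proof -
    have "1 \<le> n ^ Suc d" using n by (rule one_le_power)
    from mult_le_mono2[OF this, of c] have "c \<le> c * n ^ Suc d" by simp
    moreover have "n * poly q n \<le> n * (a * n ^ d)" using ad[OF n] by (rule mult_le_mono2)
    ultimately have "c + n * poly q n \<le> c * n ^ Suc d + n * (a * n ^ d)" by (rule add_mono)
    also have "\<dots> = (c + a) * n ^ Suc d" by (simp add: algebra_simps)
    finally show ?thesis by simp
  qed
  then show ?case by blast
qed

text \<open>The left side is at most \<open>A * n powr (d * \<kappa>)\<close> for constants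
  \<open>A\<close> and \<open>d\<close>, and a fixed power of \<open>n\<close> is eventually small
  against \<open>exp (ln 2 * n) = 2 ^ n\<close>.\<close>

lemma exponential_beats_polynomial:
  fixes q :: "nat poly" and \<kappa> :: real
  assumes "\<kappa> \<ge> 0"
  shows "\<exists>n\<ge>1. real (poly q n) powr \<kappa> < 2 ^ n"
proof -
  obtain a d where ad: "\<And>n. n \<ge> 1 \<Longrightarrow> poly q n \<le> a * n ^ d" using nat_poly_le by blast
  define A where "A = (real a + 1) powr \<kappa>"
  define D where "D = nat \<lceil>real d * \<kappa>\<rceil>"
  have A: "A \<ge> 0" by (simp add: A_def)
  have "filterlim (\<lambda>n. ln 2 * real n) at_top sequentially"
    by (rule filterlim_tendsto_pos_mult_at_top[OF tendsto_const]) (auto intro: filterlim_real_sequentially)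
  from filterlim_compose[OF tendsto_power_div_exp_0 this]
  have "((\<lambda>n. (ln 2 * real n) ^ D / exp (ln 2 * real n)) \<longlongrightarrow> 0) sequentially" .
  \<comment> \<open>The threshold is chosen so that clearing denominators yields
    \<open>(A + 1) * n ^ D < 2 ^ n\<close>.\<close>
  moreover have "0 < ln 2 ^ D / (A + 1)" using A by simp
  ultimately have "\<forall>\<^sub>F n in sequentially. (ln 2 * real n) ^ D / exp (ln 2 * real n) < ln 2 ^ D / (A + 1)"
    by (rule order_tendstoD(2))
  then have "\<forall>\<^sub>F n in sequentially. n \<ge> 1 \<and>
      (ln 2 * real n) ^ D / exp (ln 2 * real n) < ln 2 ^ D / (A + 1)"
    by (intro eventually_conj eventually_ge_at_top)
  then obtain n :: nat where n1: "n \<ge> 1"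
    and lt: "(ln 2 * real n) ^ D / exp (ln 2 * real n) < ln 2 ^ D / (A + 1)"
    using eventually_happens'[OF sequentially_bot] by blast
  have "exp (ln 2 * real n) = 2 powr real n" by (simp add: powr_def mult.commute)
  then have "ln 2 ^ D * ((A + 1) * real n ^ D) < ln 2 ^ D * 2 powr real n"
    using lt A by (simp add: divide_simps power_mult_distrib mult_ac)
  then have lt: "(A + 1) * real n ^ D < 2 powr real n" by simp
  have "real n powr (real d * \<kappa>) \<le> real n powr real D"
    using n1 assms by (intro powr_mono) (auto simp: D_def)
  then have "A * real n powr (real d * \<kappa>) \<le> (A + 1) * real n ^ D"
    using A n1 by (intro mult_mono) (auto simp: powr_realpow)
  with lt n1 have n: "n \<ge> 1" "A * real n powr (real d * \<kappa>) < 2 powr real n" by auto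
  have "real (poly q n) \<le> (real a + 1) * real n ^ d"
    using ad[OF n(1)] by (smt (verit) mult_right_mono of_nat_le_iff of_nat_mult of_nat_power zero_le_power of_nat_0_le_iff)
  then have "real (poly q n) powr \<kappa> \<le> ((real a + 1) * real n ^ d) powr \<kappa>"
    using assms by (intro powr_mono2) auto
  also have "\<dots> = A * real n powr (real d * \<kappa>)"
    using n(1) by (simp add: A_def powr_mult powr_powr flip: powr_realpow)
  finally have "real (poly q n) powr \<kappa> < 2 ^ n" using n(2) by (simp add: powr_realpow)
  then show ?thesis using n(1) by blast
qed

theorem tau_conjecture_imp_P_neq_NP:
  assumes tau_conjecture
  shows "P_C \<noteq> NP_C"
proof
  assume "P_C = NP_C"
  then have "chain_prefixes \<in> P_C" using chain_prefixes_NP by simp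
  then obtain M q where M: "decides_in_time M chain_prefixes (poly q)" by (auto simp: P_C_def)
  define X where "X = with_consts (insert 0 (instr_const ` set M))"
  have "eliminable X" unfolding X_def by (rule eliminable_finite) simp
  then obtain C where C: "\<And>n f. f \<noteq> 0 \<Longrightarrow> computes X n {f} \<Longrightarrow>
     \<exists>g::int poly. g \<noteq> 0 \<and> tau g \<le> C * (n + 1) \<and> int_roots_subset f (map_poly of_int g)"
    unfolding eliminable_def by blast
  obtain \<kappa> :: real where \<kappa>: "\<kappa> \<ge> 1" and tau: "\<And>f::int poly. f \<noteq> 0 \<Longrightarrow>
      real (card {x::int. poly f x = 0}) \<le> (real (tau f) + 1) powr \<kappa>"
    using assms unfolding tau_conjecture_def by blast
  \<comment> \<open>A bound for \<open>tau g + 1\<close>: the elimination factor \<open>C\<close>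
    applied to the \<open>8 * q + card X\<close> operations that compute \<open>F\<close>.\<close>
  define Q :: "nat poly" where "Q = [:C:] * ([:8:] * q + [:card X + 1:]) + 1"
  have "2 ^ n \<le> real (poly Q n) powr \<kappa>" if n: "n \<ge> 1" for n
  proof -
    \<comment> \<open>Non-integers are rejected, which provides infinitely many rejected
      points.\<close>
    have "- \<int> \<subseteq> {z. replicate n z \<notin> chain_prefixes}"
      using replicate_in_chain_prefixes_Ints by auto
    moreover have "infinite (- \<int> :: complex set)"
    proof
      assume "finite (- \<int> :: complex set)"
      moreover have "(\<lambda>k::nat. of_nat k + \<i>) ` UNIV \<subseteq> - \<int>"
        by (auto simp: complex_is_Int_iff)
      moreover have "infinite ((\<lambda>k::nat. of_nat k + \<i>) ` UNIV)"
        by (intro range_inj_infinite) (auto simp: inj_on_def)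
      ultimately show False using finite_subset by blast
    qed
    ultimately have "infinite {z. replicate n z \<notin> chain_prefixes}" using finite_subset by blast
    from decides_in_time_poly[OF M n this X_def] obtain F where F: "F \<noteq> 0"
      "computes X (8 * poly q n + card X) {F}" "\<And>z. replicate n z \<in> chain_prefixes \<Longrightarrow> poly F z = 0"
      by blast
    obtain g :: "int poly" where g: "g \<noteq> 0" "tau g \<le> C * (8 * poly q n + card X + 1)"
      "int_roots_subset F (map_poly of_int g)" using C[OF F(1,2)] by blast
    \<comment> \<open>Accepted points are zeros of \<open>F\<close>, and integer zeros of
      \<open>F\<close> are zeros of \<open>g\<close>.\<close>
    have "int ` {..<2 ^ n} \<subseteq> {x. poly g x = 0}"
    proof clarsimp
      fix k :: nat assume "k < 2 ^ n"
      then have "poly F (of_int (int k)) = 0"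
        using F(3) replicate_of_nat_in_chain_prefixes[OF n] by simp
      then have "poly (map_poly of_int g) (of_int (int k) :: complex) = 0"
        using g(3) unfolding int_roots_subset_def by blast
      then show "poly g (int k) = 0" unfolding poly_map_of_int by simp
    qed
    then have "card (int ` {..<2 ^ n}) \<le> card {x. poly g x = 0}"
      by (intro card_mono poly_roots_finite g)
    then have "2 ^ n \<le> card {x. poly g x = 0}" by (simp add: card_image)
    then have "2 ^ n \<le> real (card {x. poly g x = 0})" by (metis of_nat_le_iff of_nat_numeral of_nat_power)
    also have "\<dots> \<le> (real (tau g) + 1) powr \<kappa>" by (rule tau[OF g(1)])
    also have "\<dots> \<le> real (poly Q n) powr \<kappa>"
    proof (rule powr_mono2)
      have "tau g + 1 \<le> poly Q n" using g(2) by (simp add: Q_def algebra_simps)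
      then show "real (tau g) + 1 \<le> real (poly Q n)" by linarith
    qed (use \<kappa> in auto)
    finally show ?thesis .
  qed
  moreover obtain n where "n \<ge> 1" "real (poly Q n) powr \<kappa> < 2 ^ n"
    using exponential_beats_polynomial[of \<kappa> Q] \<kappa> by auto
  ultimately show False by (meson not_le)
qed

theorem theorem1:
  fixes p :: nat
  assumes "prime p"
    and "digit_conjecture p"
  shows "P_C \<noteq> NP_C \<and> tau_conjecture"
proof -
  have tau_conjecture
    using digit_conjecture_imp_tau_conjecture assms prime_gt_0_nat by blast
  then show ?thesis using tau_conjecture_imp_P_neq_NP by blast
qed

end
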